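(* Let $\mathcal S,\mathcal T$ be closed subspaces of $\mathcal H$ and $A=P_{\mathcal S}-P_{\mathcal T}$. Then $\mathcal S$ and $\mathcal T$ do not have a common complement if and only if both of the following hold: (1) $\dim N(A-1)\ne\dim N(A+1)$; (2) the restriction $A|_{\mathcal H_0}$ is compact, where $\mathcal H_0=(N(A-1)\oplus N(A+1))^\perp$ (a reducing subspace for $A$).
   Context: $\mathcal H$ is a separable complex Hilbert space; for a closed subspace $\mathcal S$, $P_{\mathcal S}$ is the orthogonal projection onto $\mathcal S$; $N(\cdot)$ denotes null space. Two closed subspaces $\mathcal S,\mathcal T$ have a common complement if there is a closed subspace $\mathcal Z$ with $\mathcal S\cap\mathcal Z=\mathcal T\cap\mathcal Z=\{0\}$ and $\mathcal S+\mathcal Z=\mathcal T+\mathcal Z=\mathcal H$. (Note $N(A-1)=\mathcal S\cap\mathcal T^\perp$ and $N(A+1)=\mathcal S^\perp\cap\mathcal T$.) *)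

theory Defs
  imports "HOL-Analysis.Analysis"
begin

text \<open>A complex Hilbert space is modelled as a real Hilbert space
  (type class real_inner + complete_space) together with a complex structure J
  (multiplication by the imaginary unit): J is real-linear, J (J x) = - x and
  J preserves the real inner product.  The complex inner product is then
  inner x y + i inner x (J y) (up to convention), and complex subspaces are the
  real subspaces invariant under J.\<close>

definition complex_structure :: "('a::real_inner \<Rightarrow> 'a) \<Rightarrow> bool" where
  "complex_structure J \<longleftrightarrow> linear J \<and> (\<forall>x. J (J x) = - x) \<and> (\<forall>x y. inner (J x) (J y) = inner x y)"

definition closed_csubspace :: "('a::real_inner \<Rightarrow> 'a) \<Rightarrow> 'a set \<Rightarrow> bool" where
  "closed_csubspace J S \<longleftrightarrow> subspace S \<and> closed S \<and> J ` S \<subseteq> S"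

definition ortho_compl :: "'a::real_inner set \<Rightarrow> 'a set" where
  "ortho_compl S = {x. \<forall>y\<in>S. inner x y = 0}"

definition orth_proj :: "'a::real_inner set \<Rightarrow> 'a \<Rightarrow> 'a" where
  "orth_proj S x = (THE y. y \<in> S \<and> x - y \<in> ortho_compl S)"

text \<open>Complex span and complex (Hilbert) dimension, infinite dimension = \<infinity>
  (in a separable space every infinite-dimensional subspace has Hilbert dimension aleph_0).\<close>
definition cspan :: "('a::real_vector \<Rightarrow> 'a) \<Rightarrow> 'a set \<Rightarrow> 'a set" where
  "cspan J B = span (B \<union> J ` B)"

definition cdim :: "('a::real_vector \<Rightarrow> 'a) \<Rightarrow> 'a set \<Rightarrow> enat" where
  "cdim J V = (if \<exists>B. finite B \<and> B \<subseteq> V \<and> cspan J B = V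
               then enat (LEAST n. \<exists>B. finite B \<and> B \<subseteq> V \<and> cspan J B = V \<and> card B = n)
               else \<infinity>)"

definition have_common_complement :: "('a::real_inner \<Rightarrow> 'a) \<Rightarrow> 'a set \<Rightarrow> 'a set \<Rightarrow> bool" where
  "have_common_complement J S T \<longleftrightarrow>
     (\<exists>Z. closed_csubspace J Z \<and> S \<inter> Z = {0} \<and> T \<inter> Z = {0} \<and>
          {s + z | s z. s \<in> S \<and> z \<in> Z} = UNIV \<and> {t + z | t z. t \<in> T \<and> z \<in> Z} = UNIV)"

definition compact_restriction :: "('a::real_normed_vector \<Rightarrow> 'a) \<Rightarrow> 'a set \<Rightarrow> bool" where
  "compact_restriction A M \<longleftrightarrow> compact (closure (A ` (M \<inter> cball 0 1)))"

end

theory Submission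
  imports Defs
begin

text \<open>
  Put \<open>N1 = S \<inter> T\<^sup>\<bottom>\<close> and \<open>N2 = T \<inter> S\<^sup>\<bottom>\<close>; these are the eigenspaces of \<open>A\<close> for \<open>1\<close> and \<open>-1\<close>.

  A complement of \<open>S\<close> and \<open>T\<close> is obtained from any bounded bijection \<open>V : T \<rightarrow> S\<close> with
  \<open>\<parallel>P\<^sub>S t - V t\<parallel> \<le> c \<parallel>t - P\<^sub>S t\<parallel>\<close>, as the closure of \<open>{t - V t} + S\<^sup>\<bottom> \<inter> T\<^sup>\<bottom>\<close>.  Such a \<open>V\<close> equals \<open>P\<^sub>S\<close> on
  \<open>T \<ominus> E\<close> and is an arbitrary isometry of \<open>E\<close> onto \<open>S \<ominus> P\<^sub>S (T \<ominus> E)\<close>, provided that \<open>P\<^sub>S\<close> is bounded below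
  on \<open>T \<ominus> E\<close>, that \<open>1 - P\<^sub>S\<close> controls \<open>P\<^sub>E\<close>, and that the two dimensions agree.  If \<open>A\<close> is compact on
  \<open>H0\<close> and \<open>dim N1 = dim N2\<close>, then \<open>E = N2\<close> works.  If \<open>A\<close> is not compact on \<open>H0\<close>, then \<open>E = T \<inter> M\<close>
  works, where \<open>M\<close> is a spectral subspace of \<open>A\<^sup>2\<close> for \<open>[\<delta>\<^sup>2, 1]\<close> with \<open>T \<inter> H0 \<inter> M\<close> infinite-dimensional:
  both dimensions are then infinite.

  Conversely let \<open>Z\<close> be a common complement, \<open>A\<close> compact on \<open>H0\<close> and \<open>dim N1 < dim N2\<close>.  The projection
  onto \<open>S\<close> along \<open>Z\<close> is bounded and injective on \<open>T\<close>.  Following it by \<open>P\<^sub>T\<close> on \<open>S \<ominus> N1\<close> and by an isometric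
  embedding of \<open>N1\<close> into a larger finite-dimensional part \<open>N\<close> of \<open>N2\<close> gives an injective compact
  perturbation of the identity on \<open>(T \<ominus> N2) \<oplus> N\<close> that is not onto, against the Fredholm alternative.
\<close>

section \<open>Orthogonal projections\<close>

text \<open>Real counterpart of \<open>closed_csubspace\<close>: projection theory is developed over
  the reals, and compatibility with \<open>J\<close> is added later by a commutation
  argument.\<close>

definition closed_subspace :: "'a::real_inner set \<Rightarrow> bool" where
  "closed_subspace S \<longleftrightarrow> subspace S \<and> closed S"

lemma closed_subspaceD: "closed_subspace S \<Longrightarrow> subspace S" "closed_subspace S \<Longrightarrow> closed S"
  by (auto simp: closed_subspace_def)

lemma closed_subspace_Int: "closed_subspace S \<Longrightarrow> closed_subspace T \<Longrightarrow> closed_subspace (S \<inter> T)"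
  by (auto simp: closed_subspace_def subspace_inter)

lemma closed_ortho_compl: "closed (ortho_compl S)"
proof -
  have "ortho_compl S = (\<Inter>y\<in>S. {x. inner x y = 0})"
    by (auto simp: ortho_compl_def)
  then show ?thesis
    by (auto intro!: closed_INT closed_Collect_eq continuous_intros)
qed

lemma closed_subspace_ortho_compl: "closed_subspace (ortho_compl S)"
  using closed_ortho_compl[of S]
  by (auto simp: closed_subspace_def subspace_def ortho_compl_def inner_left_distrib)

lemma ortho_complD: "x \<in> ortho_compl S \<Longrightarrow> y \<in> S \<Longrightarrow> inner x y = 0"
  "x \<in> ortho_compl S \<Longrightarrow> y \<in> S \<Longrightarrow> inner y x = 0"
  by (auto simp: ortho_compl_def inner_commute)

lemma ortho_complI: "(\<And>y. y \<in> S \<Longrightarrow> inner x y = 0) \<Longrightarrow> x \<in> ortho_compl S"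
  by (auto simp: ortho_compl_def)

lemma ortho_compl_Int_self: "x \<in> S \<Longrightarrow> x \<in> ortho_compl S \<Longrightarrow> x = 0"
  by (auto simp: ortho_compl_def)

text \<open>Projection theorem: the parallelogram law makes a minimizing sequence Cauchy, and
  minimality of the limit under variation along \<open>S\<close> forces its residual to be
  orthogonal to \<open>S\<close>.\<close>

lemma orth_proj_exists:
  fixes S :: "'a::{real_inner,complete_space} set"
  assumes S: "closed_subspace S"
  shows "\<exists>y\<in>S. x - y \<in> ortho_compl S"
proof -
  note sub = closed_subspaceD(1)[OF S]
  define d where "d = infdist x S"
  have ne: "S \<noteq> {}" using subspace_0[OF sub] by auto
  have dle: "d \<le> norm (x - s)" if "s \<in> S" for s
    unfolding d_def using infdist_le[OF that, of x] by (simp add: dist_norm)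
  have d0: "d \<ge> 0" by (simp add: d_def infdist_nonneg)
  have "\<exists>s\<in>S. norm (x - s) < d + 1 / real (Suc n)" for n
    using cInf_lessD[of "dist x ` S" "d + 1 / real (Suc n)"] ne infdist_notempty[OF ne, of x]
    by (auto simp: d_def dist_norm)
  then obtain y where yS: "\<And>n. y n \<in> S" and yd: "\<And>n. norm (x - y n) < d + 1 / real (Suc n)"
    by metis
  \<comment> \<open>The midpoint of \<open>y m\<close> and \<open>y n\<close> lies in
    \<open>S\<close>, hence is at distance at least \<open>d\<close> from \<open>x\<close>; the
    parallelogram law does the rest.\<close>
  have par: "norm (y m - y n) ^ 2 \<le> 2 * norm (x - y m)^2 + 2 * norm (x - y n)^2 - 4 * d^2" for m n
  proof -
    have mid: "(1/2) *\<^sub>R (y m + y n) \<in> S"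
      using yS sub by (simp add: subspace_add subspace_scale)
    have "d^2 \<le> norm (x - (1/2) *\<^sub>R (y m + y n))^2"
      using dle[OF mid] d0 by (intro power_mono) auto
    moreover have "norm (y m - y n)^2 + 4 * norm (x - (1/2) *\<^sub>R (y m + y n))^2
        = 2 * norm (x - y m)^2 + 2 * norm (x - y n)^2"
      by (simp add: power2_norm_eq_inner algebra_simps inner_commute)
    ultimately show ?thesis by simp
  qed
  have lim: "(\<lambda>n. norm (x - y n)) \<longlonglongrightarrow> d"
  proof (rule tendsto_sandwich[where f="\<lambda>n. d" and h="\<lambda>n. d + 1 / real (Suc n)"])
    show "(\<lambda>n. d + 1 / real (Suc n)) \<longlonglongrightarrow> d"
      using tendsto_add[OF tendsto_const[of d] LIMSEQ_inverse_real_of_nat] by (simp add: inverse_eq_divide)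
  qed (use dle yS yd in \<open>auto intro!: always_eventually less_imp_le\<close>)
  have "Cauchy y"
  proof (rule metric_CauchyI)
    fix e :: real assume e: "e > 0"
    have "(\<lambda>n. norm (x - y n)^2) \<longlonglongrightarrow> d^2"
      by (intro tendsto_intros lim)
    then have "eventually (\<lambda>n. norm (x - y n)^2 < d^2 + e^2/4) sequentially"
      by (rule order_tendstoD) (use e in auto)
    then obtain N where N: "\<And>n. n \<ge> N \<Longrightarrow> norm (x - y n)^2 < d^2 + e^2/4"
      by (auto simp: eventually_sequentially)
    show "\<exists>M. \<forall>m\<ge>M. \<forall>n\<ge>M. dist (y m) (y n) < e"
    proof (intro exI allI impI)
      fix m n assume "m \<ge> N" "n \<ge> N"
      then have "norm (y m - y n) ^ 2 < e^2"
        using par[of m n] N[of m] N[of n] by simp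
      then show "dist (y m) (y n) < e"
        using e by (simp add: dist_norm power2_less_imp_less)
    qed
  qed
  then obtain l where l: "y \<longlonglongrightarrow> l"
    using Cauchy_convergent convergent_def by blast
  have lS: "l \<in> S"
    using closed_sequentially[OF closed_subspaceD(2)[OF S]] yS l by blast
  have ld: "norm (x - l) = d"
    by (rule LIMSEQ_unique[OF _ lim]) (intro tendsto_intros l)
  have "x - l \<in> ortho_compl S"
  proof (rule ortho_complI)
    fix s assume s: "s \<in> S"
    show "inner (x - l) s = 0"
    proof (rule ccontr)
      assume nz: "inner (x - l) s \<noteq> 0"
      then have s0: "inner s s > 0" by auto
      \<comment> \<open>This step length minimizes the distance from \<open>x\<close> to the line
        through \<open>l\<close> in direction \<open>s\<close>, so a nonzero inner product would
        beat the minimum.\<close>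
      define a where "a = inner (x - l) s / inner s s"
      have "l + a *\<^sub>R s \<in> S" using lS s sub by (simp add: subspace_add subspace_scale)
      from power_mono[OF dle[OF this] d0, of 2]
      have "inner (x - l) (x - l) \<le> inner (x - (l + a *\<^sub>R s)) (x - (l + a *\<^sub>R s))"
        by (simp add: ld[symmetric] power2_norm_eq_inner)
      also have "\<dots> = inner (x - l) (x - l) - 2 * a * inner (x-l) s + a * a * inner s s"
        by (simp add: algebra_simps inner_commute)
      also have "\<dots> = inner (x - l) (x - l) - a * inner (x - l) s"
        using s0 by (simp add: a_def)
      finally have "a * inner (x - l) s \<le> 0" by simp
      moreover have "a * inner (x - l) s > 0"
        using nz s0 not_real_square_gt_zero[of "inner (x - l) s"]
        by (simp add: a_def zero_less_divide_iff zero_less_mult_iff)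
      ultimately show False by simp
    qed
  qed
  with lS show ?thesis by blast
qed

lemma orth_proj_unique:
  assumes S: "closed_subspace S" and y: "y \<in> S" "x - y \<in> ortho_compl S"
  shows "orth_proj S x = y"
  unfolding orth_proj_def
proof (rule the_equality)
  fix z assume z: "z \<in> S \<and> x - z \<in> ortho_compl S"
  have "z - y \<in> S" using z y subspace_diff closed_subspaceD(1)[OF S] by blast
  moreover have "z - y \<in> ortho_compl S"
    using subspace_diff[OF closed_subspaceD(1)[OF closed_subspace_ortho_compl] y(2) conjunct2[OF z]] by simp
  ultimately show "z = y" using ortho_compl_Int_self by fastforce
qed (use y in auto)

context
  fixes S :: "'a::{real_inner,complete_space} set"
  assumes S: "closed_subspace S"
begin

lemma orth_proj_in: "orth_proj S x \<in> S"
  and orth_proj_diff_in: "x - orth_proj S x \<in> ortho_compl S"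
proof -
  obtain y where y: "y \<in> S" "x - y \<in> ortho_compl S"
    using orth_proj_exists[OF S] by blast
  then show "orth_proj S x \<in> S" "x - orth_proj S x \<in> ortho_compl S"
    by (simp_all add: orth_proj_unique[OF S y])
qed

lemma orth_proj_eq: "x \<in> S \<Longrightarrow> orth_proj S x = x"
  by (rule orth_proj_unique[OF S]) (auto simp: ortho_compl_def)

lemma orth_proj_eq_0: "x \<in> ortho_compl S \<Longrightarrow> orth_proj S x = 0"
  by (rule orth_proj_unique[OF S]) (auto simp: subspace_0 closed_subspaceD[OF S])

lemma orth_proj_eq_0D: "orth_proj S x = 0 \<Longrightarrow> x \<in> ortho_compl S"
  using orth_proj_diff_in[of x] by simp

lemma linear_orth_proj: "linear (orth_proj S)"
proof -
  note s = closed_subspaceD(1)[OF S] and c = closed_subspaceD(1)[OF closed_subspace_ortho_compl[of S]]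
  show ?thesis
  proof (rule linearI)
    fix x y
    have "(x - orth_proj S x) + (y - orth_proj S y) \<in> ortho_compl S"
      by (intro subspace_add[OF c] orth_proj_diff_in)
    then show "orth_proj S (x + y) = orth_proj S x + orth_proj S y"
      by (intro orth_proj_unique[OF S] subspace_add[OF s] orth_proj_in) (simp add: algebra_simps)
  next
    fix r x
    have "r *\<^sub>R (x - orth_proj S x) \<in> ortho_compl S"
      by (intro subspace_scale[OF c] orth_proj_diff_in)
    then show "orth_proj S (r *\<^sub>R x) = r *\<^sub>R orth_proj S x"
      by (intro orth_proj_unique[OF S] subspace_scale[OF s] orth_proj_in) (simp add: algebra_simps)
  qed
qed

lemma inner_orth_proj_left: "y \<in> S \<Longrightarrow> inner (orth_proj S x) y = inner x y"
  using orth_proj_diff_in[of x] by (auto simp: ortho_compl_def inner_diff_left)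

lemma inner_orth_proj_right: "y \<in> S \<Longrightarrow> inner y (orth_proj S x) = inner y x"
  using inner_orth_proj_left by (metis inner_commute)

lemma inner_orth_proj_swap: "inner (orth_proj S x) y = inner x (orth_proj S y)"
  using inner_orth_proj_left[OF orth_proj_in[of y], of x] inner_orth_proj_right[OF orth_proj_in[of x], of y]
  by simp

lemma norm_orth_proj_pythagoras: "norm x ^ 2 = norm (orth_proj S x) ^ 2 + norm (x - orth_proj S x) ^ 2"
  using norm_add_Pythagorean[of "orth_proj S x" "x - orth_proj S x"]
    ortho_complD(2)[OF orth_proj_diff_in[of x] orth_proj_in[of x]]
  by (simp add: orthogonal_def)

lemma norm_orth_proj_le: "norm (orth_proj S x) \<le> norm x"
  by (rule power2_le_imp_le) (use norm_orth_proj_pythagoras[of x] in auto)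

lemma norm_diff_orth_proj_le: "norm (x - orth_proj S x) \<le> norm x"
  by (rule power2_le_imp_le) (use norm_orth_proj_pythagoras[of x] in auto)

lemma bounded_linear_orth_proj: "bounded_linear (orth_proj S)"
  using linear_orth_proj norm_orth_proj_le
  by (intro bounded_linear_intro[where K=1]) (auto simp: linear_add linear_scale)

text \<open>\<open>C\<close> respects both summands of \<open>x = P x + (x - P x)\<close>, so it
  carries the orthogonal decomposition of \<open>x\<close> to that of \<open>C x\<close>.\<close>

lemma orth_proj_commute:
  assumes C: "linear C" and CS: "\<And>x. x \<in> S \<Longrightarrow> C x \<in> S"
    and CS': "\<And>x. x \<in> ortho_compl S \<Longrightarrow> C x \<in> ortho_compl S"
  shows "orth_proj S (C x) = C (orth_proj S x)"
  using CS[OF orth_proj_in] CS'[OF orth_proj_diff_in, of x]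
  by (intro orth_proj_unique[OF S]) (auto simp: linear_diff[OF C])

lemma orth_proj_ortho_compl: "orth_proj (ortho_compl S) x = x - orth_proj S x"
proof (rule orth_proj_unique[OF closed_subspace_ortho_compl orth_proj_diff_in])
  show "x - (x - orth_proj S x) \<in> ortho_compl (ortho_compl S)"
    using ortho_complD(2) orth_proj_in[of x] by (auto intro!: ortho_complI)
qed

end

lemma orth_proj_subset:
  fixes S E :: "'a::{real_inner,complete_space} set"
  assumes S: "closed_subspace S" and E: "closed_subspace E" and "E \<subseteq> S"
  shows "orth_proj E (orth_proj S x) = orth_proj E x"
proof (rule orth_proj_unique[OF E orth_proj_in[OF E]])
  show "orth_proj S x - orth_proj E x \<in> ortho_compl E"
    using assms(3) by (intro ortho_complI) (auto simp: inner_diff_left inner_orth_proj_left[OF S] inner_orth_proj_left[OF E])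
qed

text \<open>The residual \<open>x - orth_proj U x\<close> of a point of \<open>S\<close> stays in
  \<open>S\<close> and is orthogonal to \<open>U\<close>. This is the test used below for totality
  of orthonormal systems and for surjectivity.\<close>

lemma dense_in_closed_subspaceI:
  fixes S U :: "'a::{real_inner,complete_space} set"
  assumes S: "closed_subspace S" and U: "closed_subspace U" "U \<subseteq> S"
    and *: "\<And>x. x \<in> S \<Longrightarrow> x \<in> ortho_compl U \<Longrightarrow> x = 0"
  shows "U = S"
proof
  show "S \<subseteq> U"
  proof
    fix x assume x: "x \<in> S"
    have "x - orth_proj U x \<in> S"
      using U(2) orth_proj_in[OF U(1), of x] by (intro subspace_diff closed_subspaceD(1)[OF S] x) blast
    from *[OF this orth_proj_diff_in[OF U(1)]] show "x \<in> U"
      using orth_proj_in[OF U(1), of x] by simp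
  qed
qed (rule U)

text \<open>The lower bound pulls the Cauchy property of a convergent sequence of images back to the
  preimages.\<close>

lemma closed_image_bounded_below:
  fixes f :: "'a::{real_inner,complete_space} \<Rightarrow> 'b::real_inner"
  assumes f: "bounded_linear f" and X: "closed_subspace X"
    and c: "c > 0" "\<And>x. x \<in> X \<Longrightarrow> c * norm x \<le> norm (f x)"
  shows "closed_subspace (f ` X)"
proof -
  interpret bounded_linear f by (rule f)
  have "closed (f ` X)"
    unfolding closed_sequential_limits
  proof (intro allI impI, elim conjE)
    fix y l assume y: "\<forall>n. y n \<in> f ` X" and l: "y \<longlonglongrightarrow> l"
    have "\<forall>n. \<exists>x. x \<in> X \<and> y n = f x" using y by blast
    then obtain x where x: "\<And>n. x n \<in> X" "\<And>n. y n = f (x n)" by metis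
    have d: "c * dist (x m) (x n) \<le> dist (y m) (y n)" for m n
      using c(2)[OF subspace_diff[OF closed_subspaceD(1)[OF X] x(1)[of m] x(1)[of n]]]
      by (simp add: dist_norm x(2) diff)
    have "Cauchy x"
    proof (rule metric_CauchyI)
      fix e :: real assume e: "e > 0"
      obtain M where M: "\<And>m n. m \<ge> M \<Longrightarrow> n \<ge> M \<Longrightarrow> dist (y m) (y n) < c * e"
        using metric_CauchyD[OF LIMSEQ_imp_Cauchy[OF l], of "c * e"] c e by auto
      have "dist (x m) (x n) < e" if "m \<ge> M" "n \<ge> M" for m n
        using le_less_trans[OF d M[OF that]] c by simp
      then show "\<exists>M. \<forall>m\<ge>M. \<forall>n\<ge>M. dist (x m) (x n) < e" by blast
    qed
    then obtain z where z: "x \<longlonglongrightarrow> z" using Cauchy_convergent convergent_def by blast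
    have "z \<in> X" using closed_sequentially[OF closed_subspaceD(2)[OF X]] x(1) z by blast
    moreover have "l = f z"
    proof (rule LIMSEQ_unique[OF l])
      have "y = (\<lambda>n. f (x n))" using x(2) by auto
      then show "y \<longlonglongrightarrow> f z" using tendsto[OF z] by simp
    qed
    ultimately show "l \<in> f ` X" by blast
  qed
  then show ?thesis
    using linear_subspace_image[OF linear_axioms closed_subspaceD(1)[OF X]]
    by (simp add: closed_subspace_def)
qed

text \<open>Hypothesis \<open>comp\<close> says sequentially that \<open>F - 1\<close> is compact on
  \<open>X\<close>. If no lower bound existed, there would be unit vectors with
  \<open>F (u n)\<close> tending to 0; a subsequence of \<open>F u - u\<close> converges, hence so
  does \<open>u\<close>, and its limit is a unit vector in the kernel.\<close>

lemma bounded_below_of_compact: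
  fixes F :: "'a::{real_inner,complete_space} \<Rightarrow> 'a"
  assumes F: "bounded_linear F" and X: "closed_subspace X"
    and inj: "\<And>x. x \<in> X \<Longrightarrow> F x = 0 \<Longrightarrow> x = 0"
    and comp: "\<And>f. (\<And>n. f n \<in> X) \<Longrightarrow> (\<And>n. norm (f n) \<le> 1) \<Longrightarrow>
      \<exists>r l. strict_mono (r::nat \<Rightarrow> nat) \<and> (\<lambda>n. F (f (r n)) - f (r n)) \<longlonglongrightarrow> l"
  shows "\<exists>d>0. \<forall>x\<in>X. d * norm x \<le> norm (F x)"
proof (rule ccontr)
  assume neg: "\<not> ?thesis"
  have "\<exists>t. t \<in> X \<and> norm (F t) < (1 / real (Suc n)) * norm t" for n
  proof (rule ccontr)
    assume "\<nexists>t. t \<in> X \<and> norm (F t) < (1 / real (Suc n)) * norm t"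
    then have "\<forall>t\<in>X. (1 / real (Suc n)) * norm t \<le> norm (F t)"
      by (metis not_less)
    moreover have "1 / real (Suc n) > 0" by simp
    ultimately show False using neg by blast
  qed
  then obtain t where t: "\<And>n. t n \<in> X" "\<And>n. norm (F (t n)) < (1 / real (Suc n)) * norm (t n)" by metis
  have tnz: "norm (t n) > 0" for n
    using t(2)[of n] norm_ge_zero[of "F (t n)"] by (cases "t n = 0") auto
  define u where "u n = t n /\<^sub>R norm (t n)" for n
  have u1: "norm (u n) = 1" for n using tnz[of n] by (simp add: u_def)
  have uX: "u n \<in> X" for n
    unfolding u_def by (rule subspace_scale[OF closed_subspaceD(1)[OF X] t(1)])
  have uF: "norm (F (u n)) \<le> inverse (real (Suc n))" for n
  proof -
    have "norm (F (u n)) = norm (F (t n)) / norm (t n)"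
      by (simp add: u_def linear_scale[OF bounded_linear.linear[OF F]] divide_inverse_commute)
    also have "\<dots> \<le> inverse (real (Suc n))"
      using t(2)[of n] tnz[of n] by (simp add: divide_le_eq inverse_eq_divide)
    finally show ?thesis .
  qed
  have F0: "(\<lambda>n. F (u n)) \<longlonglongrightarrow> 0"
    by (rule Lim_null_comparison[OF _ LIMSEQ_inverse_real_of_nat]) (use uF in auto)
  obtain r l where r: "strict_mono (r::nat \<Rightarrow> nat)" and l: "(\<lambda>n. F (u (r n)) - u (r n)) \<longlonglongrightarrow> l"
    using comp[of u] uX u1 by auto
  have F0r: "(\<lambda>n. F (u (r n))) \<longlonglongrightarrow> 0"
    using LIMSEQ_subseq_LIMSEQ[OF F0 r] by (simp add: comp_def)
  have ul: "(\<lambda>n. u (r n)) \<longlonglongrightarrow> 0 - l"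
    using tendsto_diff[OF F0r l] by simp
  have lX: "0 - l \<in> X"
    using closed_sequentially[OF closed_subspaceD(2)[OF X] _ ul] uX by blast
  have "(\<lambda>n. F (u (r n))) \<longlonglongrightarrow> F (0 - l)"
    by (rule bounded_linear.tendsto[OF F ul])
  then have "F (0 - l) = 0" using F0r LIMSEQ_unique by blast
  then have "0 - l = 0" by (rule inj[OF lX])
  moreover have "norm (0 - l) = 1"
    using tendsto_norm[OF ul] by (simp add: u1 LIMSEQ_const_iff)
  ultimately show False by simp
qed

section \<open>Complex orthonormal bases\<close>

lemma closed_subspace_closure: "subspace S \<Longrightarrow> closed_subspace (closure (S::'a::real_inner set))"
  unfolding closed_subspace_def subspace_def
proof (intro conjI ballI allI)
  assume S: "0 \<in> S \<and> (\<forall>x\<in>S. \<forall>y\<in>S. x + y \<in> S) \<and> (\<forall>c. \<forall>x\<in>S. c *\<^sub>R x \<in> S)"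
  show "0 \<in> closure S" using S closure_subset by blast
  show "x + y \<in> closure S" if x: "x \<in> closure S" and y: "y \<in> closure S" for x y
  proof -
    obtain f g where "\<forall>n. f n \<in> S" "f \<longlonglongrightarrow> x" "\<forall>n. g n \<in> S" "g \<longlonglongrightarrow> y"
      using x y unfolding closure_sequential by blast
    then show ?thesis unfolding closure_sequential
      using S by (intro exI[of _ "\<lambda>n. f n + g n"]) (auto intro: tendsto_add)
  qed
  show "c *\<^sub>R x \<in> closure S" if x: "x \<in> closure S" for x c
  proof -
    obtain f where "\<forall>n. f n \<in> S" "f \<longlonglongrightarrow> x"
      using x unfolding closure_sequential by blast
    then show ?thesis unfolding closure_sequential
      using S by (intro exI[of _ "\<lambda>n. c *\<^sub>R f n"]) (auto intro: tendsto_scaleR)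
  qed
qed auto

lemma ortho_compl_closure: "ortho_compl (closure S) = ortho_compl (S::'a::real_inner set)"
proof (intro equalityI subsetI)
  fix x assume x: "x \<in> ortho_compl S"
  have "closure S \<subseteq> {y. inner x y = 0}"
    using x by (intro closure_minimal closed_Collect_eq continuous_intros) (auto simp: ortho_compl_def)
  then show "x \<in> ortho_compl (closure S)" by (auto simp: ortho_compl_def)
next
  fix x assume "x \<in> ortho_compl (closure S)"
  then show "x \<in> ortho_compl S" using closure_subset[of S] by (auto simp: ortho_compl_def)
qed

lemma closure_invariant:
  assumes "continuous_on UNIV f" "\<And>x. x \<in> S \<Longrightarrow> f x \<in> closure S" "x \<in> closure S"
  shows "f x \<in> closure S"
  using image_closure_subset[of S f "closure S"] assms continuous_on_subset by blast

definition orthonormal :: "'a::real_inner set \<Rightarrow> bool" where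
  "orthonormal U \<longleftrightarrow> (\<forall>u\<in>U. \<forall>v\<in>U. inner u v = (if u = v then 1 else 0))"

lemma orthonormal_independent: "orthonormal U \<Longrightarrow> independent (U::'a::real_inner set)"
  by (rule pairwise_orthogonal_independent)
    (force simp: orthonormal_def pairwise_def orthogonal_def split: if_splits)+

lemma orthonormal_expansion:
  assumes U: "orthonormal U" "finite U" and x: "x \<in> span U"
  shows "x = (\<Sum>u\<in>U. inner x u *\<^sub>R u)"
proof -
  have "subspace {x. x = (\<Sum>u\<in>U. inner x u *\<^sub>R u)}"
    unfolding subspace_def
    by (auto simp: inner_add_left scaleR_add_left sum.distrib scaleR_scaleR[symmetric] scaleR_sum_right[symmetric] simp del: scaleR_scaleR)
  moreover have "v = (\<Sum>u\<in>U. inner v u *\<^sub>R u)" if v: "v \<in> U" for v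
  proof -
    have "(\<Sum>u\<in>U. inner v u *\<^sub>R u) = (\<Sum>u\<in>U. if u = v then u else 0)"
      using U(1) v by (intro sum.cong) (auto simp: orthonormal_def)
    then show ?thesis using U(2) v by simp
  qed
  ultimately show ?thesis using span_induct[OF x, of "\<lambda>x. x = (\<Sum>u\<in>U. inner x u *\<^sub>R u)"] by blast
qed

text \<open>The expansion formula describes the span as the solution set of an equation between
  continuous functions.\<close>

lemma closed_span_orthonormal:
  assumes U: "orthonormal U" "finite U"
  shows "closed (span U)"
proof -
  have "closure (span U) \<subseteq> {x. x = (\<Sum>u\<in>U. inner x u *\<^sub>R u)}"
    using orthonormal_expansion[OF U] by (intro closure_minimal closed_Collect_eq continuous_intros) auto
  also have "\<dots> \<subseteq> span U"
  proof clarify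
    fix x assume "x = (\<Sum>u\<in>U. inner x u *\<^sub>R u)"
    moreover have "(\<Sum>u\<in>U. inner x u *\<^sub>R u) \<in> span U"
      by (intro span_sum span_scale span_base)
    ultimately show "x \<in> span U" by simp
  qed
  finally show ?thesis by (simp add: closure_subset_eq)
qed

text \<open>The ambient space may be infinite-dimensional, so compactness of finite-dimensional
  balls is drawn from boxes of coefficients: each new vector gives a continuous image of an interval
  times the previous box.\<close>

lemma compact_coefficient_box:
  fixes U :: "'a::real_normed_vector set"
  assumes "finite U"
  shows "compact {\<Sum>u\<in>U. a u *\<^sub>R u |a. \<forall>u. \<bar>a u\<bar> \<le> 1}"
  using assms
proof (induction U)
  case empty
  have "{\<Sum>u\<in>{}. a u *\<^sub>R (u::'a) |a. \<forall>u. \<bar>a u\<bar> \<le> 1} = {0}"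
    by (auto intro: exI[of _ "\<lambda>_. 0"])
  then show ?case by simp
next
  case (insert v U)
  define K where "K = {\<Sum>u\<in>U. a u *\<^sub>R u |a. \<forall>u. \<bar>a u\<bar> \<le> 1}"
  have "compact ((\<lambda>p. fst p *\<^sub>R v + snd p) ` ({-1..1} \<times> K))"
    using insert.IH unfolding K_def[symmetric]
    by (intro compact_continuous_image compact_Times continuous_intros) auto
  also have "(\<lambda>p. fst p *\<^sub>R v + snd p) ` ({-1..1} \<times> K) = {\<Sum>u\<in>insert v U. a u *\<^sub>R u |a. \<forall>u. \<bar>a u\<bar> \<le> 1}"
  proof (intro equalityI subsetI)
    fix y assume "y \<in> (\<lambda>p. fst p *\<^sub>R v + snd p) ` ({-1..1} \<times> K)"
    then obtain c x where cx: "c \<in> {-1..1}" "x \<in> K" "y = c *\<^sub>R v + x" by auto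
    then obtain a where a: "x = (\<Sum>u\<in>U. a u *\<^sub>R u)" "\<And>u. \<bar>a u\<bar> \<le> 1"
      unfolding K_def by blast
    have "(\<Sum>u\<in>U. (a(v := c)) u *\<^sub>R u) = (\<Sum>u\<in>U. a u *\<^sub>R u)"
      using insert.hyps by (intro sum.cong) auto
    then have "y = (\<Sum>u\<in>insert v U. (a(v := c)) u *\<^sub>R u)"
      using insert.hyps cx(3) a(1) by simp
    moreover have "\<forall>u. \<bar>(a(v := c)) u\<bar> \<le> 1" using cx(1) a(2) by auto
    ultimately show "y \<in> {\<Sum>u\<in>insert v U. a u *\<^sub>R u |a. \<forall>u. \<bar>a u\<bar> \<le> 1}"
      by blast
  next
    fix y assume "y \<in> {\<Sum>u\<in>insert v U. a u *\<^sub>R u |a. \<forall>u. \<bar>a u\<bar> \<le> 1}"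
    then obtain a where a: "y = (\<Sum>u\<in>insert v U. a u *\<^sub>R u)" "\<forall>u. \<bar>a u\<bar> \<le> 1" by blast
    have "a v \<in> {-1..1}" using a(2)[rule_format, of v] by auto
    moreover have "(\<Sum>u\<in>U. a u *\<^sub>R u) \<in> K" using a(2) unfolding K_def by blast
    moreover have "y = fst (a v, \<Sum>u\<in>U. a u *\<^sub>R u) *\<^sub>R v + snd (a v, \<Sum>u\<in>U. a u *\<^sub>R u)"
      using a(1) insert.hyps by simp
    ultimately show "y \<in> (\<lambda>p. fst p *\<^sub>R v + snd p) ` ({-1..1} \<times> K)" by blast
  qed
  finally show ?case .
qed

lemma compact_span_orthonormal:
  assumes U: "orthonormal U" "finite U"
  shows "compact (span U \<inter> cball 0 1)"
proof -
  let ?K = "{\<Sum>u\<in>U. a u *\<^sub>R u |a. \<forall>u. \<bar>a u\<bar> \<le> 1}"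
  have sub: "span U \<inter> cball 0 1 \<subseteq> ?K"
  proof clarify
    fix x assume x: "x \<in> span U" "x \<in> cball 0 1"
    \<comment> \<open>The coefficients are set to 0 outside \<open>U\<close> because the box bounds
      \<open>a\<close> on the whole type.\<close>
    have "(\<Sum>u\<in>U. inner x u *\<^sub>R u) = (\<Sum>u\<in>U. (if u \<in> U then inner x u else 0) *\<^sub>R u)"
      by (intro sum.cong) auto
    moreover have "\<bar>if u \<in> U then inner x u else 0\<bar> \<le> 1" for u
    proof (cases "u \<in> U")
      case True
      then have "norm u = 1" using U(1) by (auto simp: orthonormal_def norm_eq_1)
      then have "\<bar>inner x u\<bar> \<le> norm x * 1" using Cauchy_Schwarz_ineq2[of x u] by simp
      then show ?thesis using x(2) by auto
    qed auto
    ultimately show "\<exists>a. x = (\<Sum>u\<in>U. a u *\<^sub>R u) \<and> (\<forall>u. \<bar>a u\<bar> \<le> 1)"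
      using orthonormal_expansion[OF U x(1)] by (intro exI[of _ "\<lambda>u. if u \<in> U then inner x u else 0"]) simp
  qed
  have "compact (?K \<inter> (span U \<inter> cball 0 1))"
    by (intro compact_Int_closed compact_coefficient_box U closed_Int closed_span_orthonormal closed_cball)
  then show ?thesis using sub by (simp add: Int_absorb1)
qed

section \<open>Complex structure, complex orthonormal systems and complex dimension\<close>

locale complex_hilbert =
  fixes J :: "'a::{real_inner,complete_space} \<Rightarrow> 'a"
  assumes J: "complex_structure J"
begin

lemma linear_J: "linear J" and J_J: "J (J x) = - x" and inner_J_J: "inner (J x) (J y) = inner x y"
  using J by (auto simp: complex_structure_def)

lemma inner_J_left: "inner (J x) y = - inner x (J y)"
  using inner_J_J[of x "J y"] by (simp add: J_J)

lemma inner_J_self: "inner x (J x) = 0" "inner (J x) x = 0"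
  using inner_J_left[of x x] by (simp_all add: inner_commute)

lemma norm_J: "norm (J x) = norm x"
  by (simp add: norm_eq_sqrt_inner inner_J_J)

lemma bounded_linear_J: "bounded_linear J"
  using linear_J norm_J by (intro bounded_linear_intro[where K=1]) (auto simp: linear_add linear_scale)

lemma closed_csubspaceD:
  assumes "closed_csubspace J V"
  shows "closed_subspace V" "x \<in> V \<Longrightarrow> J x \<in> V"
  using assms by (auto simp: closed_csubspace_def closed_subspace_def)

lemma closed_csubspaceI:
  "closed_subspace V \<Longrightarrow> (\<And>x. x \<in> V \<Longrightarrow> J x \<in> V) \<Longrightarrow> closed_csubspace J V"
  by (auto simp: closed_csubspace_def closed_subspace_def)

lemma closed_csubspace_Int: "closed_csubspace J V \<Longrightarrow> closed_csubspace J W \<Longrightarrow> closed_csubspace J (V \<inter> W)"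
  by (auto simp: closed_csubspace_def subspace_inter)

lemma J_ortho_compl: "(\<And>x. x \<in> V \<Longrightarrow> J x \<in> V) \<Longrightarrow> x \<in> ortho_compl V \<Longrightarrow> J x \<in> ortho_compl V"
  by (auto simp: ortho_compl_def inner_J_left)

lemma closed_csubspace_ortho_compl: "closed_csubspace J V \<Longrightarrow> closed_csubspace J (ortho_compl V)"
  by (rule closed_csubspaceI[OF closed_subspace_ortho_compl J_ortho_compl[OF closed_csubspaceD(2)]])

lemma orth_proj_J: "closed_csubspace J V \<Longrightarrow> orth_proj V (J x) = J (orth_proj V x)"
  by (rule orth_proj_commute[OF closed_csubspaceD(1) linear_J closed_csubspaceD(2)
        J_ortho_compl[OF closed_csubspaceD(2)]])

text \<open>Orthonormality for the complex inner product, whose real and imaginary parts are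
  \<open>inner b c\<close> and, up to sign, \<open>inner b (J c)\<close>. The set \<open>B\<close>
  together with its image under \<open>J\<close> is then orthonormal over the reals.\<close>

definition complex_orthonormal :: "'a set \<Rightarrow> bool" where
  "complex_orthonormal B \<longleftrightarrow> (\<forall>b\<in>B. \<forall>c\<in>B. inner b c = (if b = c then 1 else 0) \<and> inner b (J c) = 0)"

lemma complex_orthonormal_subset: "complex_orthonormal B \<Longrightarrow> B' \<subseteq> B \<Longrightarrow> complex_orthonormal B'"
  unfolding complex_orthonormal_def by blast

lemma complex_orthonormal_imp_orthonormal:
  assumes "complex_orthonormal B"
  shows "orthonormal (B \<union> J ` B)"
proof -
  have "inner b c = (if b = c then 1 else 0)" "inner b (J c) = 0" if "b \<in> B" "c \<in> B" for b c
    using assms that by (auto simp: complex_orthonormal_def)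
  moreover have "b \<noteq> J c" if "b \<in> B" "c \<in> B" for b c
    using calculation(1)[of b b] calculation(2)[of b c] that by auto
  moreover have "inner (J c) b = 0" if "b \<in> B" "c \<in> B" for b c
    using calculation(2)[OF that] by (simp add: inner_commute)
  ultimately show ?thesis unfolding orthonormal_def by (auto simp: inner_J_J)
qed

lemma J_image_disjoint:
  assumes "complex_orthonormal B" shows "B \<inter> J ` B = {}"
  using assms by (auto simp: complex_orthonormal_def) (metis inner_commute inner_J_J inner_zero_left zero_neq_one)

lemma inj_J: "inj J"
  by (rule inj_on_inverseI[of _ "\<lambda>x. - J x"]) (simp add: J_J)

lemma card_Un_J_image:
  assumes "complex_orthonormal B" "finite B" shows "card (B \<union> J ` B) = 2 * card B"
  using J_image_disjoint[OF assms(1)] assms(2) inj_J by (simp add: card_Un_disjoint card_image inj_on_subset)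

lemma cspan_J: "x \<in> cspan J B \<Longrightarrow> J x \<in> cspan J B"
  unfolding cspan_def
proof (rule span_induct[where P="\<lambda>x. J x \<in> span (B \<union> J ` B)"])
  show "subspace {x. J x \<in> span (B \<union> J ` B)}"
    using linear_J subspace_span[of "B \<union> J ` B"]
    by (auto simp: subspace_def linear_0 linear_add linear_scale)
  show "J x \<in> span (B \<union> J ` B)" if "x \<in> B \<union> J ` B" for x
    using that by (auto simp: J_J intro!: span_neg intro: span_base)
qed

lemma closed_csubspace_closure_cspan: "closed_csubspace J (closure (cspan J B))"
proof (rule closed_csubspaceI)
  show "closed_subspace (closure (cspan J B))"
    unfolding cspan_def by (rule closed_subspace_closure[OF subspace_span])
  show "J x \<in> closure (cspan J B)" if "x \<in> closure (cspan J B)" for x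
    using cspan_J closure_subset
    by (intro closure_invariant[OF linear_continuous_on[OF bounded_linear_J] _ that]) blast
qed

lemma closure_cspan_subset:
  assumes "closed_csubspace J V" "B \<subseteq> V"
  shows "closure (cspan J B) \<subseteq> V"
  unfolding cspan_def using assms
  by (intro closure_minimal span_minimal) (auto simp: closed_csubspace_def)

lemma closed_cspan_finite:
  assumes "complex_orthonormal B" "finite B"
  shows "closure (cspan J B) = cspan J B"
  using closed_span_orthonormal[OF complex_orthonormal_imp_orthonormal[OF assms(1)]] assms(2)
  by (simp add: cspan_def)

text \<open>Zorn's lemma gives a maximal complex orthonormal subset of \<open>V\<close>; a nonzero
  vector of \<open>V\<close> orthogonal to its closed span could be normalized and added.\<close>

lemma exists_complex_orthonormal_basis:
  assumes V: "closed_csubspace J V"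
  obtains B where "complex_orthonormal B" "B \<subseteq> V" "closure (cspan J B) = V"
proof -
  let ?A = "{B. B \<subseteq> V \<and> complex_orthonormal B}"
  have "\<exists>M\<in>?A. \<forall>X\<in>?A. M \<subseteq> X \<longrightarrow> X = M"
  proof (rule subset_Zorn')
    fix C assume "subset.chain ?A C"
    then have C: "C \<subseteq> ?A" "\<And>X Y. X \<in> C \<Longrightarrow> Y \<in> C \<Longrightarrow> X \<subseteq> Y \<or> Y \<subseteq> X"
      by (auto simp: subset_chain_def)
    have "inner b c = (if b = c then 1 else 0) \<and> inner b (J c) = 0" if bc: "b \<in> \<Union>C" "c \<in> \<Union>C" for b c
    proof -
      obtain X where "X \<in> C" "b \<in> X" "c \<in> X" using bc C(2) by blast
      then show ?thesis using C(1) unfolding complex_orthonormal_def by blast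
    qed
    then show "\<Union>C \<in> ?A" using C(1) by (auto simp: complex_orthonormal_def)
  qed
  then obtain B where B': "B \<in> ?A" and max: "\<forall>X\<in>?A. B \<subseteq> X \<longrightarrow> X = B" by (rule bexE)
  then have B: "B \<subseteq> V" "complex_orthonormal B" by auto
  have "closure (cspan J B) = V"
  proof (rule dense_in_closed_subspaceI[OF closed_csubspaceD(1)[OF V]
        closed_csubspaceD(1)[OF closed_csubspace_closure_cspan] closure_cspan_subset[OF V B(1)]])
    fix x assume x: "x \<in> V" "x \<in> ortho_compl (closure (cspan J B))"
    have ort: "inner x b = 0" "inner x (J b) = 0" if "b \<in> B" for b
      using x(2) that span_base[of _ "B \<union> J ` B"] unfolding ortho_compl_closure
      by (auto simp: ortho_compl_def cspan_def)
    show "x = 0"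
    proof (rule ccontr)
      assume x0: "x \<noteq> 0"
      define e where "e = x /\<^sub>R norm x"
      have "norm e = 1" using x0 by (simp add: e_def)
      then have e1: "inner e e = 1" by (simp add: norm_eq_1)
      have e2: "inner e b = 0" "inner e (J b) = 0" "inner b e = 0" "inner b (J e) = 0" if "b \<in> B" for b
        using ort[OF that] inner_J_left[of b e] inner_commute[of "J b" e]
        by (simp_all add: e_def inner_commute)
      have "complex_orthonormal (insert e B)"
        using B(2) e1 e2 inner_J_self[of e] unfolding complex_orthonormal_def by auto
      moreover have "insert e B \<subseteq> V"
        using B(1) x(1) V by (auto simp: e_def closed_csubspace_def subspace_scale)
      ultimately have "e \<in> B" using max by blast
      then show False using e1 e2(1) by force
    qed
  qed
  with B show ?thesis using that by blast
qed

text \<open>Links the spanning-set definition of \<open>cdim\<close> to orthonormal bases. A finite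
  complex spanning set \<open>C\<close> yields at most \<open>2 * card C\<close> real generators,
  whereas \<open>B\<close> with its \<open>J\<close>-image is independent over the reals and has
  \<open>2 * card B\<close> elements if finite.\<close>

lemma cdim_eq_card:
  assumes B: "complex_orthonormal B" and V: "closure (cspan J B) = V"
  shows "cdim J V = (if finite B then enat (card B) else \<infinity>)"
proof -
  note ind = orthonormal_independent[OF complex_orthonormal_imp_orthonormal[OF B]]
  have BV: "B \<union> J ` B \<subseteq> V"
    using V closure_subset[of "cspan J B"] span_superset[of "B \<union> J ` B"] by (auto simp: cspan_def)
  have bound: "finite B \<and> card B \<le> card C" if C: "finite C" "cspan J C = V" for C
  proof -
    have "finite (B \<union> J ` B) \<and> card (B \<union> J ` B) \<le> card (C \<union> J ` C)"
      using independent_span_bound[of "C \<union> J ` C", OF _ ind] C BV by (simp add: cspan_def)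
    moreover have "card (C \<union> J ` C) \<le> 2 * card C"
      using card_Un_le[of C "J ` C"] card_image_le[OF C(1), of J] by linarith
    ultimately show ?thesis using card_Un_J_image[OF B] by auto
  qed
  show ?thesis
  proof (cases "finite B")
    case True
    then have *: "cspan J B = V" using closed_cspan_finite[OF B] V by simp
    have "(LEAST n. \<exists>B. finite B \<and> B \<subseteq> V \<and> cspan J B = V \<and> card B = n) = card B"
      using True * BV bound by (intro Least_equality) auto
    then show ?thesis using True * BV unfolding cdim_def by auto
  next
    case False
    then show ?thesis using bound unfolding cdim_def by auto
  qed
qed

lemma cdim_finite_compact:
  assumes V: "closed_csubspace J V" and fin: "cdim J V \<noteq> \<infinity>"
  shows "compact (V \<inter> cball 0 1)"
proof -
  obtain B where B: "complex_orthonormal B" "B \<subseteq> V" "closure (cspan J B) = V"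
    by (rule exists_complex_orthonormal_basis[OF V])
  then have "finite B" using cdim_eq_card[OF B(1,3)] fin by (cases "finite B") auto
  then show ?thesis
    using compact_span_orthonormal[OF complex_orthonormal_imp_orthonormal[OF B(1)]] closed_cspan_finite[OF B(1)] B(3)
    by (simp add: cspan_def)
qed

text \<open>The counting is done over the reals: \<open>f\<close> sends the infinite independent set
  \<open>B\<close> injectively to an independent set, which cannot fit into the real span of
  finitely many vectors.\<close>

lemma cdim_infinite_image:
  assumes V: "closed_csubspace J V" and W: "closed_csubspace J W"
    and f: "linear f" "\<And>x. x \<in> V \<Longrightarrow> f x \<in> W" "\<And>x. x \<in> V \<Longrightarrow> f x = 0 \<Longrightarrow> x = 0"
    and inf: "cdim J V = \<infinity>"
  shows "cdim J W = \<infinity>"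
proof (rule ccontr)
  assume fin: "cdim J W \<noteq> \<infinity>"
  obtain B where B: "complex_orthonormal B" "B \<subseteq> V" "closure (cspan J B) = V"
    by (rule exists_complex_orthonormal_basis[OF V])
  obtain C where C: "complex_orthonormal C" "C \<subseteq> W" "closure (cspan J C) = W"
    by (rule exists_complex_orthonormal_basis[OF W])
  have infB: "infinite B" using inf cdim_eq_card[OF B(1,3)] by (cases "finite B") auto
  have finC: "finite C" using fin cdim_eq_card[OF C(1,3)] by (cases "finite C") auto
  have "span B \<subseteq> V" using B(2) V by (intro span_minimal) (auto simp: closed_csubspace_def)
  then have inj: "inj_on f (span B)"
    using f(3) by (subst linear_injective_on_subspace_0[OF f(1) subspace_span]) blast
  have "independent (f ` B)"
    using complex_orthonormal_imp_orthonormal[OF B(1)] orthonormal_independent independent_mono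
    by (intro linear_independent_injective_image f(1) inj) blast
  moreover have "f ` B \<subseteq> span (C \<union> J ` C)"
    using f(2) B(2) C closed_cspan_finite[OF C(1) finC] by (auto simp: cspan_def)
  ultimately have "finite (f ` B)"
    using independent_span_bound[of "C \<union> J ` C" "f ` B"] finC by simp
  moreover have "inj_on f B" by (rule inj_on_subset[OF inj span_superset])
  ultimately show False using infB by (simp add: finite_image_iff)
qed

text \<open>Distinct members are at distance \<open>sqrt 2\<close>, so points of \<open>D\<close>
  chosen within 1/2 of them are distinct.\<close>

lemma countable_complex_orthonormal:
  assumes B: "complex_orthonormal B" and D: "countable (D::'a set)" "closure D = UNIV"
  shows "countable B"
proof -
  have "\<exists>d\<in>D. dist d b < 1/2" for b
    using D(2) closure_approachable[of b D] by (metis UNIV_I half_gt_zero zero_less_one)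
  then obtain g where g: "\<And>b. g b \<in> D" "\<And>b. dist (g b) b < 1/2" by metis
  have "inj_on g B"
  proof (rule inj_onI, rule ccontr)
    fix b c assume bc: "b \<in> B" "c \<in> B" "g b = g c" "b \<noteq> c"
    have "dist b c < 1"
      using g(2)[of b] g(2)[of c] bc(3) dist_triangle[of b c "g b"] by (simp add: dist_commute)
    then have "norm (b - c) ^ 2 < 1" by (simp add: dist_norm abs_square_less_1)
    moreover have "norm (b - c) ^ 2 = 2"
      using B bc unfolding complex_orthonormal_def
      by (simp add: power2_norm_eq_inner inner_diff_left inner_diff_right)
    ultimately show False by simp
  qed
  moreover have "countable (g ` B)" using g(1) by (intro countable_subset[OF _ D(1)]) blast
  ultimately show ?thesis by (rule countable_image_inj_on[rotated])
qed

text \<open>The bijection extends complex-linearly to the algebraic span, where it preserves inner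
  products; being uniformly continuous it extends to the closure, and all its properties pass to
  limits.\<close>

lemma isometry_of_bases:
  assumes B: "complex_orthonormal B" and B': "complex_orthonormal B'" and bij: "bij_betw \<phi> B B'"
  obtains W where "linear W" "\<And>x. norm (W x) \<le> norm x"
    "\<And>x. x \<in> closure (cspan J B) \<Longrightarrow> norm (W x) = norm x"
    "W ` closure (cspan J B) = closure (cspan J B')"
    "\<And>x. x \<in> closure (cspan J B) \<Longrightarrow> W (J x) = J (W x)"
proof -
  define U where "U = B \<union> J ` B"
  define V where "V = closure (cspan J B)"
  have V: "V = closure (span U)" by (simp add: V_def U_def cspan_def)
  have cV: "closed_csubspace J V" unfolding V_def by (rule closed_csubspace_closure_cspan)
  note sV = closed_csubspaceD(1)[OF cV] and JV = closed_csubspaceD(2)[OF cV]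
  have "independent U"
    unfolding U_def by (rule orthonormal_independent[OF complex_orthonormal_imp_orthonormal[OF B]])
  \<comment> \<open>An element of \<open>U\<close> outside \<open>B\<close> is
    \<open>u = J b\<close>, and \<open>- J u\<close> recovers \<open>b\<close>.\<close>
  then obtain g where g: "linear g" and
    gU: "\<And>u. u \<in> U \<Longrightarrow> g u = (if u \<in> B then \<phi> u else J (\<phi> (- J u)))"
    using linear_independent_extend[of U "\<lambda>u. if u \<in> B then \<phi> u else J (\<phi> (- J u))"] by blast
  have g1: "g b = \<phi> b" if "b \<in> B" for b using gU[of b] that by (simp add: U_def)
  have g2: "g (J b) = J (\<phi> b)" if "b \<in> B" for b
  proof -
    have "J b \<notin> B" using J_image_disjoint[OF B] that by blast
    then show ?thesis using gU[of "J b"] that by (simp add: U_def J_J)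
  qed
  have phi: "inner (\<phi> b) (\<phi> c) = inner b c" "inner (\<phi> b) (J (\<phi> c)) = 0" "inner b (J c) = 0"
    if "b \<in> B" "c \<in> B" for b c
  proof -
    have "\<phi> b \<in> B'" "\<phi> c \<in> B'" "\<phi> b = \<phi> c \<longleftrightarrow> b = c"
      using bij that by (auto simp: bij_betw_def inj_on_def)
    then show "inner (\<phi> b) (\<phi> c) = inner b c" "inner (\<phi> b) (J (\<phi> c)) = 0" "inner b (J c) = 0"
      using B B' that by (simp_all add: complex_orthonormal_def)
  qed
  have gUU: "inner (g u) (g v) = inner u v" if uv: "u \<in> U" "v \<in> U" for u v
    using uv unfolding U_def by (auto simp: g1 g2 phi J_J inner_J_left)
  have gU2: "inner (g x) (g v) = inner x v" if "x \<in> span U" "v \<in> U" for x v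
    using that(1)
    by (rule span_induct[where P="\<lambda>x. inner (g x) (g v) = inner x v"])
      (use gUU that(2) in \<open>auto simp: subspace_def linear_0[OF g] linear_add[OF g] linear_scale[OF g] inner_add_left\<close>)
  have ginner: "inner (g x) (g y) = inner x y" if "x \<in> span U" "y \<in> span U" for x y
    using that(2)
    by (rule span_induct[where P="\<lambda>y. inner (g x) (g y) = inner x y"])
      (use gU2 that(1) in \<open>auto simp: subspace_def linear_0[OF g] linear_add[OF g] linear_scale[OF g] inner_add_right\<close>)
  have gnorm: "norm (g x) = norm x" if "x \<in> span U" for x
    by (simp add: norm_eq_sqrt_inner ginner that)
  have gJ: "g (J x) = J (g x)" if "x \<in> span U" for x
    using that
  proof (rule span_induct[where P="\<lambda>x. g (J x) = J (g x)"])
    show "subspace {x. g (J x) = J (g x)}"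
      by (auto simp: subspace_def linear_0[OF g] linear_add[OF g] linear_scale[OF g]
          linear_0[OF linear_J] linear_add[OF linear_J] linear_scale[OF linear_J])
    show "g (J u) = J (g u)" if "u \<in> U" for u
      using that unfolding U_def by (auto simp: g1 g2 J_J linear_neg[OF g])
  qed
  have gdist: "dist (g x) (g y) = dist x y" if "x \<in> span U" "y \<in> span U" for x y
    using gnorm[OF span_diff[OF that]] by (simp add: dist_norm linear_diff[OF g])
  have "uniformly_continuous_on (span U) g"
    unfolding uniformly_continuous_on_def using gdist by auto
  then obtain k where k: "uniformly_continuous_on V k" and kg: "\<And>x. x \<in> span U \<Longrightarrow> g x = k x"
    using uniformly_continuous_on_extension_on_closure[of "span U" g] unfolding V by metis
  have kcont: "continuous_on V k" using k by (rule uniformly_continuous_imp_continuous)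
  have lim: "(\<lambda>n. g (f n)) \<longlonglongrightarrow> k x" if "\<And>n. f n \<in> span U" "f \<longlonglongrightarrow> x" for f x
  proof -
    have "x \<in> V" using that unfolding V closure_sequential by blast
    moreover have "f n \<in> V" for n using that(1) closure_subset unfolding V by blast
    ultimately have "(k \<circ> f) \<longlonglongrightarrow> k x"
      using kcont that(2) unfolding continuous_on_sequentially by blast
    then show ?thesis using kg[OF that(1)] by (simp add: comp_def)
  qed
  have approx: "\<exists>f. (\<forall>n. f n \<in> span U) \<and> f \<longlonglongrightarrow> x" if "x \<in> V" for x
    using that unfolding V closure_sequential by blast
  have kadd: "k (x + y) = k x + k y" if xy: "x \<in> V" "y \<in> V" for x y
  proof -
    obtain f h where f: "\<And>n. f n \<in> span U" "f \<longlonglongrightarrow> x" and h: "\<And>n. h n \<in> span U" "h \<longlonglongrightarrow> y"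
      using approx xy by metis
    have "(\<lambda>n. g (f n + h n)) \<longlonglongrightarrow> k (x + y)"
      by (rule lim) (auto intro: span_add tendsto_add f h)
    moreover have "(\<lambda>n. g (f n + h n)) \<longlonglongrightarrow> k x + k y"
      unfolding linear_add[OF g] by (intro tendsto_add lim f h)
    ultimately show ?thesis by (rule LIMSEQ_unique)
  qed
  have kscale: "k (c *\<^sub>R x) = c *\<^sub>R k x" if x: "x \<in> V" for c x
  proof -
    obtain f where f: "\<And>n. f n \<in> span U" "f \<longlonglongrightarrow> x" using approx x by metis
    have "(\<lambda>n. g (c *\<^sub>R f n)) \<longlonglongrightarrow> k (c *\<^sub>R x)"
      by (rule lim) (auto intro: span_scale tendsto_scaleR f)
    moreover have "(\<lambda>n. g (c *\<^sub>R f n)) \<longlonglongrightarrow> c *\<^sub>R k x"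
      unfolding linear_scale[OF g] by (intro tendsto_scaleR tendsto_const lim f)
    ultimately show ?thesis by (rule LIMSEQ_unique)
  qed
  have knorm: "norm (k x) = norm x" if x: "x \<in> V" for x
  proof -
    obtain f where f: "\<And>n. f n \<in> span U" "f \<longlonglongrightarrow> x" using approx x by metis
    have "(\<lambda>n. norm (f n)) \<longlonglongrightarrow> norm (k x)"
      using tendsto_norm[OF lim[OF f]] by (simp add: gnorm f)
    then show ?thesis using LIMSEQ_unique tendsto_norm[OF f(2)] by blast
  qed
  have kJ: "k (J x) = J (k x)" if x: "x \<in> V" for x
  proof -
    obtain f where f: "\<And>n. f n \<in> span U" "f \<longlonglongrightarrow> x" using approx x by metis
    have "(\<lambda>n. g (J (f n))) \<longlonglongrightarrow> k (J x)"
      using cspan_J[of _ B] f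
      by (intro lim bounded_linear.tendsto[OF bounded_linear_J]) (auto simp: U_def cspan_def)
    moreover have "(\<lambda>n. g (J (f n))) \<longlonglongrightarrow> J (k x)"
      unfolding gJ[OF f(1)] by (intro bounded_linear.tendsto[OF bounded_linear_J] lim f)
    ultimately show ?thesis by (rule LIMSEQ_unique)
  qed
  \<comment> \<open>The extension \<open>k\<close> is controlled on \<open>V\<close> alone;
    composing with the projection gives a linear contraction of the whole space.\<close>
  define W where "W = (\<lambda>x. k (orth_proj V x))"
  have WV: "W x = k x" if "x \<in> V" for x by (simp add: W_def orth_proj_eq[OF sV that])
  have lW: "linear W"
    unfolding W_def using linear_orth_proj[OF sV]
    by (intro linearI) (simp_all add: linear_add linear_scale kadd kscale orth_proj_in[OF sV])
  have nW: "norm (W x) \<le> norm x" for x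
    unfolding W_def using norm_orth_proj_le[OF sV] by (simp add: knorm orth_proj_in[OF sV])
  have bW: "bounded_linear W"
    using lW nW by (intro bounded_linear_intro[where K=1]) (auto simp: linear_add linear_scale)
  have "g ` U = B' \<union> J ` B'"
  proof -
    have "B' = \<phi> ` B" using bij by (simp add: bij_betw_def)
    moreover have "g ` B = \<phi> ` B" using g1 by simp
    moreover have "g ` J ` B = J ` \<phi> ` B" using g2 by (simp add: image_image)
    ultimately show ?thesis by (simp add: U_def image_Un)
  qed
  then have gspan: "g ` span U = cspan J B'"
    using linear_span_image[OF g, of U] by (simp add: cspan_def)
  have "W ` V = closure (cspan J B')"
  proof
    \<comment> \<open>An isometric image of a closed subspace is closed, so containing the span of
      \<open>B'\<close> it contains its closure.\<close>
    have "closed (W ` V)"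
      using closed_image_bounded_below[OF bW sV, of 1] WV knorm by (auto simp: closed_subspace_def)
    moreover have "cspan J B' \<subseteq> W ` V"
      unfolding gspan[symmetric]
      using kg WV closure_subset[of "span U"] unfolding V by (auto intro!: image_eqI)
    ultimately show "closure (cspan J B') \<subseteq> W ` V" by (rule closure_minimal[rotated])
    show "W ` V \<subseteq> closure (cspan J B')"
    proof
      fix y assume "y \<in> W ` V"
      then obtain x where x: "x \<in> V" "y = k x" using WV by auto
      obtain f where f: "\<And>n. f n \<in> span U" "f \<longlonglongrightarrow> x" using approx x(1) by metis
      have "g (f n) \<in> cspan J B'" for n using f(1) gspan by blast
      then show "y \<in> closure (cspan J B')"
        using lim[OF f] x(2) unfolding closure_sequential by (intro exI[of _ "\<lambda>n. g (f n)"]) simp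
    qed
  qed
  then show ?thesis
    using that[of W] lW nW WV knorm kJ JV unfolding V_def by simp
qed

text \<open>Separability enters here: infinite orthonormal bases are all countably infinite, so
  equal \<open>cdim\<close> always gives a bijection of bases.\<close>

lemma isometry_of_cdim_eq:
  assumes D: "countable (D::'a set)" "closure D = UNIV"
    and V: "closed_csubspace J V" and V': "closed_csubspace J V'" and eq: "cdim J V = cdim J V'"
  obtains W where "linear W" "\<And>x. norm (W x) \<le> norm x" "\<And>x. x \<in> V \<Longrightarrow> norm (W x) = norm x"
    "W ` V = V'" "\<And>x. x \<in> V \<Longrightarrow> W (J x) = J (W x)"
proof -
  obtain B where B: "complex_orthonormal B" "B \<subseteq> V" "closure (cspan J B) = V"
    by (rule exists_complex_orthonormal_basis[OF V])
  obtain B' where B': "complex_orthonormal B'" "B' \<subseteq> V'" "closure (cspan J B') = V'"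
    by (rule exists_complex_orthonormal_basis[OF V'])
  note c = countable_complex_orthonormal[OF B(1) D] countable_complex_orthonormal[OF B'(1) D]
  have eq': "(if finite B then enat (card B) else \<infinity>) = (if finite B' then enat (card B') else \<infinity>)"
    using eq by (simp add: cdim_eq_card[OF B(1,3)] cdim_eq_card[OF B'(1,3)])
  have "\<exists>\<phi>. bij_betw \<phi> B B'"
  proof (cases "finite B")
    case True
    then have "finite B'" "card B = card B'" using eq' by (auto split: if_splits)
    then show ?thesis using True finite_same_card_bij by blast
  next
    case False
    then have "infinite B'" using eq' by (auto split: if_splits)
    then show ?thesis
      using bij_betw_trans[OF to_nat_on_infinite[OF c(1) False] bij_betw_from_nat_into[OF c(2)]] by blast
  qed
  then obtain \<phi> where "bij_betw \<phi> B B'" by blast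
  then show ?thesis by (rule isometry_of_bases[OF B(1) B'(1), unfolded B(3) B'(3)]) (rule that)
qed

text \<open>The smaller dimension is finite. Choose one more basis vector of \<open>V'\<close> than
  \<open>V\<close> has and map the basis of \<open>V\<close> onto all but \<open>b\<close>; then
  \<open>b\<close> is orthogonal to the image. Keeping \<open>N\<close> finite-dimensional makes its
  unit ball compact even if \<open>V'\<close> is infinite-dimensional.\<close>

lemma isometry_into_larger:
  assumes V: "closed_csubspace J V" and V': "closed_csubspace J V'" and less: "cdim J V < cdim J V'"
  obtains W N b where "linear W" "\<And>x. norm (W x) \<le> norm x" "\<And>x. x \<in> V \<Longrightarrow> norm (W x) = norm x"
    "W ` V \<subseteq> N" "closed_csubspace J N" "N \<subseteq> V'" "compact (N \<inter> cball 0 1)" "b \<in> N" "b \<notin> W ` V"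
proof -
  obtain B where B: "complex_orthonormal B" "B \<subseteq> V" "closure (cspan J B) = V"
    by (rule exists_complex_orthonormal_basis[OF V])
  obtain B' where B': "complex_orthonormal B'" "B' \<subseteq> V'" "closure (cspan J B') = V'"
    by (rule exists_complex_orthonormal_basis[OF V'])
  have lt: "(if finite B then enat (card B) else \<infinity>) < (if finite B' then enat (card B') else \<infinity>)"
    using less by (simp add: cdim_eq_card[OF B(1,3)] cdim_eq_card[OF B'(1,3)])
  then have finB: "finite B" by (auto split: if_splits)
  have "\<exists>C. C \<subseteq> B' \<and> finite C \<and> card C = Suc (card B)"
  proof (cases "finite B'")
    case True
    then have "Suc (card B) \<le> card B'" using lt finB by simp
    then obtain C where "C \<subseteq> B'" "card C = Suc (card B)" "finite C" using obtain_subset_with_card_n by metis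
    then show ?thesis by blast
  next
    case False
    then obtain C where "finite C" "card C = Suc (card B)" "C \<subseteq> B'" using infinite_arbitrarily_large by blast
    then show ?thesis by blast
  qed
  then obtain C where C: "C \<subseteq> B'" "finite C" "card C = Suc (card B)" by blast
  obtain b where b: "b \<in> C" using C by fastforce
  have "card B = card (C - {b})" using C b by simp
  then obtain \<phi> where bij: "bij_betw \<phi> B (C - {b})"
    using finite_same_card_bij[OF finB] C(2) by blast
  have cC: "complex_orthonormal C" "complex_orthonormal (C - {b})"
    using complex_orthonormal_subset[OF B'(1)] C(1) by blast+
  obtain W where W: "linear W" "\<And>x. norm (W x) \<le> norm x" "\<And>x. x \<in> V \<Longrightarrow> norm (W x) = norm x"
    "W ` V = closure (cspan J (C - {b}))" "\<And>x. x \<in> V \<Longrightarrow> W (J x) = J (W x)"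
    by (rule isometry_of_bases[OF B(1) cC(2) bij, unfolded B(3)]) (rule that)
  define N where "N = closure (cspan J C)"
  have N: "closed_csubspace J N" unfolding N_def by (rule closed_csubspace_closure_cspan)
  show ?thesis
  proof (rule that[OF W(1-3)])
    show "W ` V \<subseteq> N" unfolding W(4) N_def cspan_def by (intro closure_mono span_mono) auto
    show "closed_csubspace J N" by (rule N)
    show "N \<subseteq> V'" unfolding N_def using C(1) B'(2) by (intro closure_cspan_subset[OF V']) blast
    show "compact (N \<inter> cball 0 1)"
      using cdim_finite_compact[OF N] cdim_eq_card[OF cC(1) N_def[symmetric]] C(2) by simp
    show "b \<in> N"
      unfolding N_def cspan_def using b by (intro subsetD[OF closure_subset] span_base) simp
    show "b \<notin> W ` V"
    proof
      assume "b \<in> W ` V"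
      moreover have "closure (cspan J (C - {b})) \<subseteq> {x. inner b x = 0}"
        unfolding cspan_def
      proof (intro closure_minimal span_minimal)
        show "(C - {b}) \<union> J ` (C - {b}) \<subseteq> {x. inner b x = 0}"
          using cC(1) b unfolding complex_orthonormal_def by auto
        show "subspace {x. inner b x = 0}" by (auto simp: subspace_def inner_add_right)
        show "closed {x. inner b x = 0}" by (intro closed_Collect_eq continuous_intros)
      qed
      ultimately have "inner b b = 0" unfolding W(4) by blast
      then show False using cC(1) b unfolding complex_orthonormal_def by auto
    qed
  qed
qed

end

section \<open>Spectral subspaces of a self-adjoint operator\<close>

text \<open>\<open>poly_like B U u\<close> collects what is needed of a polynomial \<open>U = q(B)\<close> with nonnegative
  coefficients and \<open>u = q(1)\<close>.  The iterates \<open>Y\<^sub>n\<^sub>+\<^sub>1 = (B + Y\<^sub>n\<^sup>2) / 2\<close> have differences of this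
  kind, so they converge in norm because the scalar iterates do; their limit \<open>Y\<close> satisfies
  \<open>(1 - Y)\<^sup>2 = 1 - B\<close>.\<close>

definition poly_like :: "('a::real_inner \<Rightarrow> 'a) \<Rightarrow> ('a \<Rightarrow> 'a) \<Rightarrow> real \<Rightarrow> bool" where
  "poly_like B U u \<longleftrightarrow> linear U \<and> 0 \<le> u \<and> (\<forall>x. norm (U x) \<le> u * norm x)
     \<and> (\<forall>x y. inner (U x) y = inner x (U y))
     \<and> (\<forall>C. bounded_linear C \<longrightarrow> (\<forall>x. C (B x) = B (C x)) \<longrightarrow> (\<forall>x. C (U x) = U (C x)))"

lemma poly_likeD:
  assumes "poly_like B U u"
  shows "linear U" "0 \<le> u" "norm (U x) \<le> u * norm x" "inner (U x) y = inner x (U y)"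
    "bounded_linear C \<Longrightarrow> (\<And>x. C (B x) = B (C x)) \<Longrightarrow> C (U x) = U (C x)"
  using assms unfolding poly_like_def by auto

lemma poly_like_bounded_linear: "poly_like B U u \<Longrightarrow> bounded_linear U"
  using poly_likeD(1-3)[of B U u]
  by (intro bounded_linear_intro[where K=u]) (auto simp: linear_add linear_scale mult.commute)

lemma poly_like_add:
  assumes U: "poly_like B U u" and V: "poly_like B V v"
  shows "poly_like B (\<lambda>x. U x + V x) (u + v)"
  unfolding poly_like_def
proof (intro conjI allI impI)
  show "linear (\<lambda>x. U x + V x)" by (intro linear_compose_add poly_likeD(1)[OF U] poly_likeD(1)[OF V])
  show "0 \<le> u + v" using poly_likeD(2)[OF U] poly_likeD(2)[OF V] by simp
  show "norm (U x + V x) \<le> (u + v) * norm x" for x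
    using norm_triangle_ineq[of "U x" "V x"] poly_likeD(3)[OF U, of x] poly_likeD(3)[OF V, of x]
    by (simp add: distrib_right)
  show "inner (U x + V x) y = inner x (U y + V y)" for x y
    by (simp add: inner_add_left inner_add_right poly_likeD(4)[OF U] poly_likeD(4)[OF V])
  show "C (U x + V x) = U (C x) + V (C x)" if "bounded_linear C" "\<forall>x. C (B x) = B (C x)" for C x
    using poly_likeD(5)[OF U that(1)] poly_likeD(5)[OF V that(1)] that by (simp add: linear_add bounded_linear.linear)
qed

lemma poly_like_scale:
  assumes U: "poly_like B U u" and c: "0 \<le> c"
  shows "poly_like B (\<lambda>x. c *\<^sub>R U x) (c * u)"
  unfolding poly_like_def
proof (intro conjI allI impI)
  show "linear (\<lambda>x. c *\<^sub>R U x)" by (intro linear_compose_scale_right poly_likeD(1)[OF U])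
  show "0 \<le> c * u" using poly_likeD(2)[OF U] c by simp
  show "norm (c *\<^sub>R U x) \<le> (c * u) * norm x" for x
    using mult_left_mono[OF poly_likeD(3)[OF U, of x] c] c by (simp add: mult.assoc)
  show "inner (c *\<^sub>R U x) y = inner x (c *\<^sub>R U y)" for x y
    by (simp add: poly_likeD(4)[OF U])
  show "C (c *\<^sub>R U x) = c *\<^sub>R U (C x)" if "bounded_linear C" "\<forall>x. C (B x) = B (C x)" for C x
    using poly_likeD(5)[OF U that(1)] that by (simp add: linear_scale bounded_linear.linear)
qed

text \<open>The commutant clause is used twice: with \<open>C = B\<close> it shows that
  \<open>V\<close> commutes with \<open>B\<close>, and then with \<open>C = V\<close> that
  \<open>V\<close> commutes with \<open>U\<close>.\<close>

lemma poly_like_commute: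
  assumes B: "bounded_linear B" and U: "poly_like B U u" and V: "poly_like B V v"
  shows "U (V x) = V (U x)"
proof -
  have "V (B x) = B (V x)" for x using poly_likeD(5)[OF V B, of x] by simp
  from poly_likeD(5)[OF U poly_like_bounded_linear[OF V] this] show ?thesis by simp
qed

lemma poly_like_mult:
  assumes B: "bounded_linear B" and U: "poly_like B U u" and V: "poly_like B V v"
  shows "poly_like B (\<lambda>x. U (V x)) (u * v)"
  unfolding poly_like_def
proof (intro conjI allI impI)
  show "linear (\<lambda>x. U (V x))"
    using linear_compose[OF poly_likeD(1)[OF V] poly_likeD(1)[OF U]] by (simp add: comp_def)
  show "0 \<le> u * v" using poly_likeD(2)[OF U] poly_likeD(2)[OF V] by simp
  show "norm (U (V x)) \<le> (u * v) * norm x" for x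
    using order_trans[OF poly_likeD(3)[OF U] mult_left_mono[OF poly_likeD(3)[OF V] poly_likeD(2)[OF U]]]
    by (simp add: mult.assoc)
  show "inner (U (V x)) y = inner x (U (V y))" for x y
    by (simp add: poly_likeD(4)[OF U] poly_likeD(4)[OF V] poly_like_commute[OF B U V])
  show "C (U (V x)) = U (V (C x))" if "bounded_linear C" "\<forall>x. C (B x) = B (C x)" for C x
    using poly_likeD(5)[OF U that(1)] poly_likeD(5)[OF V that(1)] that by simp
qed

section \<open>The square-root iteration and its scalar majorant\<close>

fun sqrt_iter :: "('a::real_inner \<Rightarrow> 'a) \<Rightarrow> nat \<Rightarrow> 'a \<Rightarrow> 'a" where
  "sqrt_iter B 0 = (\<lambda>x. 0)"
| "sqrt_iter B (Suc n) = (\<lambda>x. (1/2) *\<^sub>R (B x + sqrt_iter B n (sqrt_iter B n x)))"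

fun sqrt_iter_real :: "nat \<Rightarrow> real" where
  "sqrt_iter_real 0 = 0"
| "sqrt_iter_real (Suc n) = (1/2) * (1 + sqrt_iter_real n * sqrt_iter_real n)"

lemma sqrt_iter_real_bounds: "0 \<le> sqrt_iter_real n \<and> sqrt_iter_real n \<le> 1"
proof (induction n)
  case (Suc n)
  then have "sqrt_iter_real n * sqrt_iter_real n \<le> 1 * 1" by (intro mult_mono) auto
  then show ?case using Suc by simp
qed simp

context
  fixes B :: "'a::{real_inner,complete_space} \<Rightarrow> 'a"
  assumes B: "poly_like B B 1"
begin

lemma poly_like_sqrt_iter: "poly_like B (sqrt_iter B n) (sqrt_iter_real n)"
proof (induction n)
  case 0
  show ?case by (auto simp: poly_like_def linear_0 bounded_linear.linear intro!: linearI)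
next
  case (Suc n)
  show ?case
    using poly_like_scale[OF poly_like_add[OF B poly_like_mult[OF poly_like_bounded_linear[OF B] Suc Suc]], of "1/2"] by simp
qed

text \<open>Since the iterates commute, consecutive differences satisfy
  \<open>Y'' - Y' = (Y' - Y)(Y' + Y) / 2\<close>, and the scalar iterates obey the same recursion.
  Thus the property passes from each difference to the next.\<close>

lemma poly_like_sqrt_iter_diff:
  "poly_like B (\<lambda>x. sqrt_iter B (Suc n) x - sqrt_iter B n x) (sqrt_iter_real (Suc n) - sqrt_iter_real n)"
proof (induction n)
  case 0
  show ?case using poly_like_scale[OF B, of "1/2"] by simp
next
  case (Suc n)
  let ?Y = "sqrt_iter B" and ?y = sqrt_iter_real
  note lin = poly_likeD(1)[OF poly_like_sqrt_iter]
  have comm: "?Y (Suc n) (?Y n x) = ?Y n (?Y (Suc n) x)" for x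
    by (rule poly_like_commute[OF poly_like_bounded_linear[OF B] poly_like_sqrt_iter poly_like_sqrt_iter])
  have *: "poly_like B (\<lambda>x. (1/2) *\<^sub>R (?Y (Suc n) (?Y (Suc n) x + ?Y n x) - ?Y n (?Y (Suc n) x + ?Y n x)))
      ((1/2) * ((?y (Suc n) - ?y n) * (?y (Suc n) + ?y n)))"
    by (intro poly_like_scale poly_like_mult[OF poly_like_bounded_linear[OF B] Suc
          poly_like_add[OF poly_like_sqrt_iter poly_like_sqrt_iter]]) auto
  have e1: "(\<lambda>x. (1/2) *\<^sub>R (?Y (Suc n) (?Y (Suc n) x + ?Y n x) - ?Y n (?Y (Suc n) x + ?Y n x)))
      = (\<lambda>x. ?Y (Suc (Suc n)) x - ?Y (Suc n) x)"
  proof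
    fix x
    have "?Y (Suc (Suc n)) x - ?Y (Suc n) x = (1/2) *\<^sub>R (?Y (Suc n) (?Y (Suc n) x) - ?Y n (?Y n x))"
      unfolding sqrt_iter.simps(2)[of B "Suc n"] by (subst (3) sqrt_iter.simps(2)) (simp add: algebra_simps)
    then show "(1/2) *\<^sub>R (?Y (Suc n) (?Y (Suc n) x + ?Y n x) - ?Y n (?Y (Suc n) x + ?Y n x))
      = ?Y (Suc (Suc n)) x - ?Y (Suc n) x"
      by (simp only: linear_add[OF lin] comm) (simp add: algebra_simps del: sqrt_iter.simps)
  qed
  have e2: "(1/2) * ((?y (Suc n) - ?y n) * (?y (Suc n) + ?y n)) = ?y (Suc (Suc n)) - ?y (Suc n)"
    unfolding sqrt_iter_real.simps(2)[of "Suc n"] by (subst (4) sqrt_iter_real.simps(2)) (simp add: algebra_simps del: sqrt_iter_real.simps)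
  show ?case using * unfolding e1 e2 .
qed

lemma poly_like_sqrt_iter_diff':
  assumes "m \<le> n"
  shows "poly_like B (\<lambda>x. sqrt_iter B n x - sqrt_iter B m x) (sqrt_iter_real n - sqrt_iter_real m)"
  using assms
proof (induction n rule: dec_induct)
  case base
  show ?case by (auto simp: poly_like_def linear_0 bounded_linear.linear intro!: linearI)
next
  case (step n)
  from poly_like_add[OF poly_like_sqrt_iter_diff[of n] step.IH]
  show ?case by (simp del: sqrt_iter.simps sqrt_iter_real.simps)
qed

text \<open>Differences of the operator iterates are dominated by differences of the scalar
  iterates, which increase and are bounded by 1.\<close>

lemma sqrt_iter_convergent: "convergent (\<lambda>n. sqrt_iter B n x)"
proof -
  have "incseq sqrt_iter_real"
    using poly_likeD(2)[OF poly_like_sqrt_iter_diff] by (intro incseq_SucI) (simp del: sqrt_iter_real.simps)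
  then have "convergent sqrt_iter_real"
    using sqrt_iter_real_bounds incseq_convergent[of sqrt_iter_real 1] by (metis convergent_def)
  then have C: "Cauchy sqrt_iter_real" by (rule convergent_Cauchy)
  have le: "dist (sqrt_iter B m x) (sqrt_iter B n x) \<le> dist (sqrt_iter_real m) (sqrt_iter_real n) * norm x" for m n
  proof (induction m n rule: linorder_wlog)
    case (le m n)
    show ?case
      using poly_likeD(3)[OF poly_like_sqrt_iter_diff'[OF le], of x] poly_likeD(2)[OF poly_like_sqrt_iter_diff'[OF le]]
      by (simp add: dist_norm dist_real_def norm_minus_commute abs_minus_commute)
  qed (simp add: dist_commute)
  have "Cauchy (\<lambda>n. sqrt_iter B n x)"
  proof (rule metric_CauchyI)
    fix e :: real assume e: "e > 0"
    obtain M where M: "\<And>m n. m \<ge> M \<Longrightarrow> n \<ge> M \<Longrightarrow> dist (sqrt_iter_real m) (sqrt_iter_real n) < e / (norm x + 1)"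
      using metric_CauchyD[OF C, of "e / (norm x + 1)"] e by (auto simp: add_nonneg_pos)
    have "dist (sqrt_iter B m x) (sqrt_iter B n x) < e" if "m \<ge> M" "n \<ge> M" for m n
    proof -
      have "dist (sqrt_iter_real m) (sqrt_iter_real n) * norm x \<le> dist (sqrt_iter_real m) (sqrt_iter_real n) * (norm x + 1)"
        by (intro mult_left_mono) auto
      also have "\<dots> < e" using M[OF that] by (simp add: pos_less_divide_eq add_nonneg_pos)
      finally show ?thesis using le[of m n] by linarith
    qed
    then show "\<exists>M. \<forall>m\<ge>M. \<forall>n\<ge>M. dist (sqrt_iter B m x) (sqrt_iter B n x) < e" by blast
  qed
  then show ?thesis by (rule Cauchy_convergent)
qed

lemma sqrt_one_minus_exists:
  "\<exists>Y. poly_like B Y 1 \<and> (\<forall>x. 2 *\<^sub>R Y x = B x + Y (Y x))"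
proof -
  define Y where "Y x = lim (\<lambda>n. sqrt_iter B n x)" for x
  have lim: "(\<lambda>n. sqrt_iter B n x) \<longlonglongrightarrow> Y x" for x
    using sqrt_iter_convergent[of x] by (simp add: Y_def convergent_LIMSEQ_iff)
  note P = poly_likeD[OF poly_like_sqrt_iter]
  have n1: "norm (sqrt_iter B n x) \<le> norm x" for n x
    using P(3)[of n x] sqrt_iter_real_bounds[of n] mult_right_mono[of "sqrt_iter_real n" 1 "norm x"]
    by simp
  have lY: "linear Y"
  proof (rule linearI)
    fix x y c
    have "(\<lambda>n. sqrt_iter B n (x + y)) \<longlonglongrightarrow> Y x + Y y"
      unfolding linear_add[OF P(1)] by (intro tendsto_intros lim)
    then show "Y (x + y) = Y x + Y y" using lim LIMSEQ_unique by blast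
    have "(\<lambda>n. sqrt_iter B n (c *\<^sub>R x)) \<longlonglongrightarrow> c *\<^sub>R Y x"
      unfolding linear_scale[OF P(1)] by (intro tendsto_intros lim)
    then show "Y (c *\<^sub>R x) = c *\<^sub>R Y x" using lim LIMSEQ_unique by blast
  qed
  have nY: "norm (Y x) \<le> norm x" for x
    by (rule LIMSEQ_le_const2[OF tendsto_norm[OF lim]]) (use n1 in auto)
  have sY: "inner (Y x) y = inner x (Y y)" for x y
  proof (rule LIMSEQ_unique)
    show "(\<lambda>n. inner (sqrt_iter B n x) y) \<longlonglongrightarrow> inner (Y x) y" by (intro tendsto_intros lim)
    show "(\<lambda>n. inner (sqrt_iter B n x) y) \<longlonglongrightarrow> inner x (Y y)"
      unfolding P(4) by (intro tendsto_intros lim)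
  qed
  \<comment> \<open>Split \<open>Y\<^sub>n (Y\<^sub>n x)\<close> into
    \<open>Y\<^sub>n (Y\<^sub>n x - Y x)\<close>, which vanishes in the limit because every
    \<open>Y\<^sub>n\<close> is a contraction, and \<open>Y\<^sub>n (Y x)\<close>.\<close>
  have YY: "(\<lambda>n. sqrt_iter B n (sqrt_iter B n x)) \<longlonglongrightarrow> Y (Y x)" for x
  proof -
    have "(\<lambda>n. sqrt_iter B n (sqrt_iter B n x - Y x)) \<longlonglongrightarrow> 0"
    proof (rule Lim_null_comparison)
      show "\<forall>\<^sub>F n in sequentially. norm (sqrt_iter B n (sqrt_iter B n x - Y x)) \<le> norm (sqrt_iter B n x - Y x)"
        using n1 by simp
      show "(\<lambda>n. norm (sqrt_iter B n x - Y x)) \<longlonglongrightarrow> 0"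
        using lim[of x] by (simp add: LIM_zero tendsto_norm_zero)
    qed
    from tendsto_add[OF this lim[of "Y x"]] show ?thesis by (simp add: linear_diff[OF P(1)])
  qed
  have cY: "C (Y x) = Y (C x)" if C: "bounded_linear C" "\<forall>x. C (B x) = B (C x)" for C x
  proof (rule LIMSEQ_unique)
    show "(\<lambda>n. C (sqrt_iter B n x)) \<longlonglongrightarrow> C (Y x)" by (rule bounded_linear.tendsto[OF C(1) lim])
    have "C (sqrt_iter B n x) = sqrt_iter B n (C x)" for n using P(5)[OF C(1)] C(2) by simp
    then show "(\<lambda>n. C (sqrt_iter B n x)) \<longlonglongrightarrow> Y (C x)" using lim[of "C x"] by simp
  qed
  have eq: "2 *\<^sub>R Y x = B x + Y (Y x)" for x
  proof (rule LIMSEQ_unique)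
    show "(\<lambda>n. 2 *\<^sub>R sqrt_iter B (Suc n) x) \<longlonglongrightarrow> 2 *\<^sub>R Y x"
      by (intro tendsto_intros LIMSEQ_Suc lim)
    show "(\<lambda>n. 2 *\<^sub>R sqrt_iter B (Suc n) x) \<longlonglongrightarrow> B x + Y (Y x)"
      by (simp add: scaleR_add_right[symmetric] tendsto_add YY)
  qed
  show ?thesis using lY nY sY cY eq unfolding poly_like_def by (intro exI[of _ Y]) auto
qed

end

text \<open>With \<open>R\<close> the absolute value of \<open>X\<close>, the subspace
  \<open>M\<close> is the kernel of \<open>R - X\<close>. As \<open>R\<close> and \<open>X\<close>
  commute and \<open>R\<^sup>2 = X\<^sup>2\<close>, the range of \<open>R + X\<close> lies in
  \<open>M\<close>, so \<open>X = - R\<close> on the orthogonal complement; nonnegativity of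
  \<open>R\<close> gives both signs. Invariance of \<open>M\<close> under the commutant of
  \<open>X\<close> is inherited from \<open>R\<close>.\<close>

theorem spectral_splitting:
  fixes X :: "'a::{real_inner,complete_space} \<Rightarrow> 'a"
  assumes X: "linear X" and nX: "\<And>x. norm (X x) \<le> norm x" and sX: "\<And>x y. inner (X x) y = inner x (X y)"
  obtains M where "closed_subspace M" "\<And>x. x \<in> M \<Longrightarrow> 0 \<le> inner (X x) x"
    "\<And>x. x \<in> ortho_compl M \<Longrightarrow> inner (X x) x \<le> 0"
    "\<And>C x. bounded_linear C \<Longrightarrow> \<forall>y. C (X y) = X (C y) \<Longrightarrow> x \<in> M \<Longrightarrow> C x \<in> M"
proof -
  \<comment> \<open>Chosen so that \<open>1 - B = X\<^sup>2\<close>; the root of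
    \<open>1 - B\<close> supplied by the iteration is then \<open>R = 1 - Y\<close>.\<close>
  define B where "B = (\<lambda>x. x - X (X x))"
  have bX: "bounded_linear X"
    using X nX by (intro bounded_linear_intro[where K=1]) (auto simp: linear_add linear_scale)
  have nB: "norm (B x) \<le> norm x" for x
  proof -
    have "norm (B x) ^ 2 = norm x ^ 2 - 2 * norm (X x) ^ 2 + norm (X (X x)) ^ 2"
      by (simp add: B_def power2_norm_eq_inner inner_diff_left inner_diff_right sX[of "X x" x] sX[of x "X x"])
    also have "\<dots> \<le> norm x ^ 2"
      using power_mono[OF nX[of "X x"] norm_ge_zero, of 2] zero_le_power2[of "norm (X x)"] by linarith
    finally show ?thesis by (rule power2_le_imp_le) simp
  qed
  have pB: "poly_like B B 1"
    unfolding poly_like_def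
  proof (intro conjI allI impI)
    show "linear B" unfolding B_def
      by (intro linear_compose_sub linear_id[unfolded id_def] linear_compose[OF X X, unfolded comp_def])
    show "inner (B x) y = inner x (B y)" for x y
      by (simp add: B_def inner_diff_left inner_diff_right sX)
  qed (use nB in auto)
  obtain Y where Y: "poly_like B Y 1" and Y2: "\<And>x. 2 *\<^sub>R Y x = B x + Y (Y x)"
    using sqrt_one_minus_exists[OF pB] by blast
  have lY: "linear Y" by (rule poly_likeD(1)[OF Y])
  have bY: "bounded_linear Y" by (rule poly_like_bounded_linear[OF Y])
  have commB: "C (B x) = B (C x)" if "bounded_linear C" "\<And>y. C (X y) = X (C y)" for C x
    using that by (simp add: B_def linear_diff bounded_linear.linear)
  have XY: "X (Y x) = Y (X x)" for x
    by (rule poly_likeD(5)[OF Y bX]) (rule commB[OF bX], rule refl)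
  define R where "R x = x - Y x" for x
  have bR: "bounded_linear R"
    unfolding R_def by (intro bounded_linear_sub bounded_linear_ident bY)
  have sR: "inner (R x) y = inner x (R y)" for x y
    by (simp add: R_def inner_diff_left inner_diff_right poly_likeD(4)[OF Y])
  have RR: "R (R x) = X (X x)" for x
  proof -
    have "R (R x) = x - 2 *\<^sub>R Y x + Y (Y x)"
      by (simp add: R_def linear_diff[OF lY] scaleR_2)
    then show ?thesis by (simp add: Y2 B_def)
  qed
  have XR: "X (R x) = R (X x)" for x
    by (simp add: R_def linear_diff[OF X] XY)
  have R0: "0 \<le> inner (R x) x" for x
  proof -
    have "inner (Y x) x \<le> norm (Y x) * norm x" by (rule norm_cauchy_schwarz)
    also have "\<dots> \<le> norm x * norm x" using poly_likeD(3)[OF Y, of x] by (intro mult_right_mono) auto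
    finally show ?thesis by (simp add: R_def inner_diff_left power2_norm_eq_inner[symmetric] power2_eq_square)
  qed
  define M where "M = {x. R x = X x}"
  show ?thesis
  proof (rule that[of M])
    have "closed M" unfolding M_def
      by (intro closed_Collect_eq linear_continuous_on bR bX)
    then show "closed_subspace M"
      unfolding closed_subspace_def M_def subspace_def
      using bounded_linear.linear[OF bR] X by (auto simp: linear_0 linear_add linear_scale)
    show "0 \<le> inner (X x) x" if "x \<in> M" for x using R0[of x] that by (simp add: M_def)
    show "inner (X x) x \<le> 0" if x: "x \<in> ortho_compl M" for x
    proof -
      have "inner (R x + X x) z = 0" for z
      proof -
        have "R z + X z \<in> M"
          by (simp add: M_def linear_add[OF bounded_linear.linear[OF bR]] linear_add[OF X] RR XR)
        from ortho_complD(1)[OF x this] show ?thesis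
          by (simp add: inner_add_left inner_add_right sR sX)
      qed
      then have "R x + X x = 0" by (metis inner_eq_zero_iff)
      then have "X x = - R x" by (simp add: eq_neg_iff_add_eq_0 add.commute)
      then show ?thesis using R0[of x] by simp
    qed
    show "C x \<in> M" if C: "bounded_linear C" "\<forall>y. C (X y) = X (C y)" and x: "x \<in> M" for C x
    proof -
      have "C (R x) = R (C x)"
        using poly_likeD(5)[OF Y C(1) commB[OF C(1) C(2)[rule_format]]]
        by (simp add: R_def linear_diff[OF bounded_linear.linear[OF C(1)]])
      then show ?thesis using x C(2) by (simp add: M_def)
    qed
  qed
qed

section \<open>Construction of common complements\<close>

lemma compact_restrictionD:
  assumes "compact_restriction B M" "\<And>n. f n \<in> M" "\<And>n. norm (f n) \<le> 1"
  obtains r l where "strict_mono (r :: nat \<Rightarrow> nat)" "(\<lambda>n. B (f (r n))) \<longlonglongrightarrow> l"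
proof -
  have "B (f n) \<in> closure (B ` (M \<inter> cball 0 1))" for n
    using assms(2,3) by (intro subsetD[OF closure_subset]) auto
  moreover have "seq_compact (closure (B ` (M \<inter> cball 0 1)))"
    using assms(1) unfolding compact_restriction_def by (rule compact_imp_seq_compact)
  ultimately obtain r l where "strict_mono (r::nat \<Rightarrow> nat)" "((\<lambda>n. B (f n)) \<circ> r) \<longlonglongrightarrow> l"
    using seq_compactE[of "closure (B ` (M \<inter> cball 0 1))" "\<lambda>n. B (f n)"] by metis
  then show ?thesis using that by (simp add: comp_def)
qed

locale subspace_pair = complex_hilbert J
  for J :: "'a::{real_inner,complete_space} \<Rightarrow> 'a" +
  fixes S T :: "'a set"
  assumes S: "closed_csubspace J S" and T: "closed_csubspace J T"
begin

abbreviation "P\<^sub>S \<equiv> orth_proj S"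
abbreviation "P\<^sub>T \<equiv> orth_proj T"

lemmas closed_S = closed_csubspaceD(1)[OF S] and closed_T = closed_csubspaceD(1)[OF T]
lemmas subspace_S = closed_subspaceD(1)[OF closed_S] and subspace_T = closed_subspaceD(1)[OF closed_T]
lemmas J_T = closed_csubspaceD(2)[OF T]
lemmas linear_PS = linear_orth_proj[OF closed_S] and linear_PT = linear_orth_proj[OF closed_T]
lemmas PS_in = orth_proj_in[OF closed_S] and PT_in = orth_proj_in[OF closed_T]

text \<open>The closeness bound makes \<open>Z\<close> a graph over
  \<open>S\<^sup>\<bottom>\<close>: on \<open>Z\<close> the map \<open>Q = 1 - P\<^sub>S\<close> is
  bounded below, and its range is dense in \<open>S\<^sup>\<bottom>\<close>. Hence \<open>Z\<close>
  complements \<open>S\<close>. Since \<open>t - V t\<close> lies in \<open>Z\<close>, elements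
  \<open>V t\<close> of \<open>S\<close> and \<open>t\<close> of \<open>T\<close> are
  interchangeable modulo \<open>Z\<close>, which transfers the result to \<open>T\<close>.\<close>

lemma common_complement_of_iso:
  assumes V: "linear V" "V ` T = S" "\<And>t. t \<in> T \<Longrightarrow> V t = 0 \<Longrightarrow> t = 0"
    and VJ: "\<And>t. t \<in> T \<Longrightarrow> V (J t) = J (V t)"
    and c: "0 \<le> c" and close: "\<And>t. t \<in> T \<Longrightarrow> norm (P\<^sub>S t - V t) \<le> c * norm (t - P\<^sub>S t)"
  shows "have_common_complement J S T"
proof -
  define C where "C = ortho_compl S \<inter> ortho_compl T"
  have C: "closed_csubspace J C"
    unfolding C_def by (intro closed_csubspace_Int closed_csubspace_ortho_compl S T)
  note sC = closed_subspaceD(1)[OF closed_csubspaceD(1)[OF C]]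
  define Q where "Q x = x - P\<^sub>S x" for x
  have lQ: "linear Q"
    unfolding Q_def[abs_def] by (intro linear_compose_sub linear_PS linear_ident)
  have bQ: "bounded_linear Q"
    unfolding Q_def[abs_def] by (intro bounded_linear_sub bounded_linear_ident bounded_linear_orth_proj closed_S)
  define Z1 where "Z1 = {t - V t + w |t w. t \<in> T \<and> w \<in> C}"
  have VS: "V t \<in> S" if "t \<in> T" for t using V(2) that by blast
  have sub: "subspace Z1"
  proof (rule subspaceI)
    have "0 = 0 - V 0 + 0 \<and> (0::'a) \<in> T \<and> (0::'a) \<in> C"
      using subspace_0[OF subspace_T] subspace_0[OF sC] by (simp add: linear_0[OF V(1)])
    then show "0 \<in> Z1" unfolding Z1_def by blast
  next
    fix x y assume "x \<in> Z1" "y \<in> Z1"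
    then obtain t w t' w' where *: "x = t - V t + w" "t \<in> T" "w \<in> C" "y = t' - V t' + w'" "t' \<in> T" "w' \<in> C"
      unfolding Z1_def by blast
    then have "x + y = (t + t') - V (t + t') + (w + w')" by (simp add: linear_add[OF V(1)])
    then show "x + y \<in> Z1" unfolding Z1_def
      using subspace_add[OF subspace_T *(2,5)] subspace_add[OF sC *(3,6)] by blast
  next
    fix r x assume "x \<in> Z1"
    then obtain t w where *: "x = t - V t + w" "t \<in> T" "w \<in> C" unfolding Z1_def by blast
    then have "r *\<^sub>R x = r *\<^sub>R t - V (r *\<^sub>R t) + r *\<^sub>R w"
      by (simp add: linear_scale[OF V(1)] scaleR_diff_right scaleR_add_right)
    then show "r *\<^sub>R x \<in> Z1" unfolding Z1_def
      using subspace_scale[OF subspace_T *(2)] subspace_scale[OF sC *(3)] by blast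
  qed
  have inT: "t - V t \<in> Z1" if "t \<in> T" for t
  proof -
    have "t - V t = t - V t + 0 \<and> t \<in> T \<and> 0 \<in> C" using that subspace_0[OF sC] by simp
    then show ?thesis unfolding Z1_def by blast
  qed
  have inC: "w \<in> Z1" if "w \<in> C" for w
  proof -
    have "w = 0 - V 0 + w \<and> 0 \<in> T \<and> w \<in> C" using that subspace_0[OF subspace_T] by (simp add: linear_0[OF V(1)])
    then show ?thesis unfolding Z1_def by blast
  qed
  have JZ1: "J z \<in> Z1" if z: "z \<in> Z1" for z
  proof -
    obtain t w where *: "z = t - V t + w" "t \<in> T" "w \<in> C" using z unfolding Z1_def by blast
    then have "J z = J t - V (J t) + J w" by (simp add: linear_add[OF linear_J] linear_diff[OF linear_J] VJ)
    then show ?thesis unfolding Z1_def using J_T[OF *(2)] closed_csubspaceD(2)[OF C *(3)] by blast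
  qed
  define Z where "Z = closure Z1"
  have Z: "closed_csubspace J Z"
  proof (rule closed_csubspaceI)
    show "closed_subspace Z" unfolding Z_def by (rule closed_subspace_closure[OF sub])
    show "J x \<in> Z" if "x \<in> Z" for x
      unfolding Z_def
      by (rule closure_invariant[OF linear_continuous_on[OF bounded_linear_J] _ that[unfolded Z_def]])
        (rule subsetD[OF closure_subset JZ1])
  qed
  note cZ = closed_csubspaceD(1)[OF Z]
  have Z1Z: "z \<in> Z" if "z \<in> Z1" for z using that closure_subset unfolding Z_def by blast
  have "norm (P\<^sub>S z) \<le> c * norm (Q z)" if z: "z \<in> Z1" for z
  proof -
    obtain t w where *: "z = t - V t + w" "t \<in> T" "w \<in> C" using z unfolding Z1_def by blast
    have w: "w \<in> ortho_compl S" "w \<in> ortho_compl T" using * by (auto simp: C_def)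
    have P: "P\<^sub>S z = P\<^sub>S t - V t"
      using orth_proj_eq[OF closed_S VS[OF *(2)]] orth_proj_eq_0[OF closed_S w(1)]
      by (simp add: * linear_add[OF linear_PS] linear_diff[OF linear_PS])
    then have Qz: "Q z = Q t + w" by (simp add: Q_def *)
    \<comment> \<open>Because \<open>w\<close> is orthogonal to both \<open>t\<close> and
      \<open>P\<^sub>S t\<close>, adding it can only increase the norm of \<open>Q t\<close>, so the
      bound for \<open>t\<close> survives.\<close>
    have "inner (Q t) w = 0"
      using ortho_complD(2)[OF w(2) *(2)] ortho_complD(2)[OF w(1) PS_in[of t]]
      by (simp add: Q_def inner_diff_left)
    then have "norm (Q z) ^ 2 = norm (Q t) ^ 2 + norm w ^ 2"
      unfolding Qz by (intro norm_add_Pythagorean) (simp add: orthogonal_def)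
    then have "norm (Q t) ^ 2 \<le> norm (Q z) ^ 2" by simp
    then have "norm (Q t) \<le> norm (Q z)" by (rule power2_le_imp_le) simp
    then show ?thesis
      using close[OF *(2)] mult_left_mono[OF _ c] unfolding P Q_def by fastforce
  qed
  then have "Z \<subseteq> {z. norm (P\<^sub>S z) \<le> c * norm (Q z)}"
    unfolding Z_def
    by (intro closure_minimal closed_Collect_le continuous_intros linear_continuous_on bQ
        bounded_linear_orth_proj closed_S) auto
  then have zQ: "norm z \<le> (c + 1) * norm (Q z)" if "z \<in> Z" for z
    using that norm_triangle_ineq[of "P\<^sub>S z" "Q z"] by (auto simp: Q_def distrib_right)
  have QZ: "closed_subspace (Q ` Z)"
    by (rule closed_image_bounded_below[OF bQ cZ, of "1 / (c + 1)"])
      (use c zQ in \<open>auto simp: field_simps\<close>)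
  have QS: "Q ` Z = ortho_compl S"
  proof (rule dense_in_closed_subspaceI[OF closed_subspace_ortho_compl QZ])
    show "Q ` Z \<subseteq> ortho_compl S" using orth_proj_diff_in[OF closed_S] by (auto simp: Q_def)
    \<comment> \<open>Such a \<open>y\<close> is orthogonal to \<open>T\<close> as well, so it
      belongs to \<open>C\<close>, hence to \<open>Z\<close>; as \<open>Q y = y\<close>, it is
      orthogonal to itself. This is why \<open>C\<close> is included in \<open>Z1\<close>.\<close>
    fix y assume y: "y \<in> ortho_compl S" "y \<in> ortho_compl (Q ` Z)"
    have "inner y t = 0" if "t \<in> T" for t
    proof -
      have "Q (t - V t) = Q t"
        using orth_proj_eq[OF closed_S VS[OF that]] by (simp add: linear_diff[OF lQ]) (simp add: Q_def)
      then have "Q t \<in> Q ` Z" using Z1Z[OF inT[OF that]] by (metis imageI)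
      then have "inner y (Q t) = 0" by (rule ortho_complD(1)[OF y(2)])
      then show ?thesis using ortho_complD(1)[OF y(1) PS_in[of t]] by (simp add: Q_def inner_diff_right)
    qed
    then have "y \<in> C" using y(1) by (auto simp: C_def intro: ortho_complI)
    moreover have "Q y = y" using orth_proj_eq_0[OF closed_S y(1)] by (simp add: Q_def)
    ultimately have "y \<in> Q ` Z" using Z1Z[OF inC] by (metis imageI)
    then show "y = 0" using y(2) by (rule ortho_compl_Int_self)
  qed
  have SZ: "\<exists>s\<in>S. \<exists>z\<in>Z. x = s + z" for x
  proof -
    have "Q x \<in> Q ` Z" unfolding QS Q_def by (rule orth_proj_diff_in[OF closed_S])
    then obtain z where z: "z \<in> Z" "Q x = Q z" by blast
    then have "x - z = P\<^sub>S (x - z)" by (simp add: Q_def linear_diff[OF linear_PS] algebra_simps)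
    then have "x - z \<in> S" using PS_in by metis
    then show ?thesis using z(1) by (intro bexI[of _ "x - z"] bexI[of _ z]) auto
  qed
  have SiZ: "z = 0" if "z \<in> S" "z \<in> Z" for z
    using zQ[OF that(2)] orth_proj_eq[OF closed_S that(1)] by (simp add: Q_def)
  have TZ: "\<exists>t\<in>T. \<exists>z\<in>Z. x = t + z" for x
  proof -
    obtain s z where sz: "s \<in> S" "z \<in> Z" "x = s + z" using SZ by blast
    then obtain t where t: "t \<in> T" "s = V t" using V(2) by blast
    have "z - (t - V t) \<in> Z"
      using sz(2) Z1Z[OF inT[OF t(1)]] subspace_diff[OF closed_subspaceD(1)[OF cZ]] by blast
    then show ?thesis using t sz(3) by (intro bexI[of _ t] bexI[of _ "z - (t - V t)"]) auto
  qed
  have TiZ: "t = 0" if "t \<in> T" "t \<in> Z" for t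
  proof -
    have "t - (t - V t) \<in> Z"
      using that(2) Z1Z[OF inT[OF that(1)]] subspace_diff[OF closed_subspaceD(1)[OF cZ]] by blast
    then have "V t = 0" using SiZ[of "V t"] VS[OF that(1)] by simp
    then show ?thesis using V(3) that(1) by blast
  qed
  have z0: "0 \<in> S" "0 \<in> T" "0 \<in> Z"
    using subspace_0 subspace_S subspace_T closed_subspaceD(1)[OF cZ] by blast+
  show ?thesis
    unfolding have_common_complement_def
  proof (intro exI[of _ Z] conjI Z)
    show "S \<inter> Z = {0}" "T \<inter> Z = {0}" using SiZ TiZ z0 by blast+
    show "{s + z |s z. s \<in> S \<and> z \<in> Z} = UNIV" using SZ by blast
    show "{t + z |t z. t \<in> T \<and> z \<in> Z} = UNIV" using TZ by blast
  qed
qed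

text \<open>The map \<open>V\<close> of the preceding lemma is glued from \<open>P\<^sub>S\<close>
  on the complement \<open>E'\<close> of \<open>E\<close> in \<open>T\<close> and an isometry
  \<open>W\<close> of \<open>E\<close> onto \<open>F\<close>. The bound with \<open>d\<close> makes
  the image of \<open>E'\<close> closed, so \<open>S\<close> is its orthogonal sum with
  \<open>F\<close>; the bound with \<open>c\<close> supplies the closeness.\<close>

lemma common_complement_criterion:
  assumes D: "countable (D::'a set)" "closure D = UNIV"
    and E: "closed_csubspace J E" "E \<subseteq> T"
    and c: "0 \<le> c" "\<And>t. t \<in> T \<Longrightarrow> norm (orth_proj E t) \<le> c * norm (t - P\<^sub>S t)"
    and d: "0 < d" "\<And>t. t \<in> T \<Longrightarrow> t \<in> ortho_compl E \<Longrightarrow> d * norm t \<le> norm (P\<^sub>S t)"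
    and dim: "cdim J E = cdim J (S \<inter> ortho_compl (T \<inter> ortho_compl E))"
  shows "have_common_complement J S T"
proof -
  define E' where "E' = T \<inter> ortho_compl E"
  \<comment> \<open>For vectors of \<open>S\<close>, orthogonality to \<open>E'\<close> and to
    \<open>P\<^sub>S E'\<close> are the same, so \<open>F\<close> is the complement of
    \<open>P\<^sub>S E'\<close> inside \<open>S\<close>.\<close>
  define F where "F = S \<inter> ortho_compl E'"
  have E': "closed_csubspace J E'"
    unfolding E'_def by (intro closed_csubspace_Int closed_csubspace_ortho_compl T E(1))
  have F: "closed_csubspace J F"
    unfolding F_def by (intro closed_csubspace_Int closed_csubspace_ortho_compl S E')
  note cE = closed_csubspaceD(1)[OF E(1)]
  obtain W where W: "linear W" "\<And>x. norm (W x) \<le> norm x" "\<And>x. x \<in> E \<Longrightarrow> norm (W x) = norm x"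
    "W ` E = F" "\<And>x. x \<in> E \<Longrightarrow> W (J x) = J (W x)"
    by (rule isometry_of_cdim_eq[OF D E(1) F]) (use dim in \<open>simp_all add: F_def E'_def\<close>)
  let ?p = "orth_proj E"
  have lp: "linear ?p" by (rule linear_orth_proj[OF cE])
  have pE: "?p x \<in> E" for x by (rule orth_proj_in[OF cE])
  have qE': "t - ?p t \<in> E'" if "t \<in> T" for t
    using that pE[of t] E(2) orth_proj_diff_in[OF cE] subspace_diff[OF subspace_T] unfolding E'_def by blast
  define V where "V t = P\<^sub>S (t - ?p t) + W (?p t)" for t
  have G: "closed_subspace (P\<^sub>S ` E')"
    by (rule closed_image_bounded_below[OF bounded_linear_orth_proj[OF closed_S] closed_csubspaceD(1)[OF E'] d(1)])
      (use d(2) in \<open>auto simp: E'_def\<close>)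
  show ?thesis
  proof (rule common_complement_of_iso[of V "2 * c"])
    show "linear V"
      unfolding V_def[abs_def]
      by (intro linear_compose_add linear_compose[OF _ linear_PS, unfolded comp_def]
          linear_compose[OF _ W(1), unfolded comp_def] linear_compose_sub linear_ident lp)
    show "V ` T = S"
    proof (intro equalityI subsetI)
      fix s assume "s \<in> V ` T"
      then obtain t where "s = P\<^sub>S (t - ?p t) + W (?p t)" by (auto simp: V_def)
      moreover have "W (?p t) \<in> S" using W(4) pE unfolding F_def by blast
      ultimately show "s \<in> S" using subspace_add[OF subspace_S PS_in] by blast
    next
      fix s assume s: "s \<in> S"
      obtain e' where e': "e' \<in> E'" "orth_proj (P\<^sub>S ` E') s = P\<^sub>S e'"
        using orth_proj_in[OF G, of s] by blast
      have sS: "s - P\<^sub>S e' \<in> S" by (rule subspace_diff[OF subspace_S s PS_in])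
      have "inner (s - P\<^sub>S e') y = 0" if y: "y \<in> E'" for y
      proof -
        have "inner (s - P\<^sub>S e') (P\<^sub>S y) = 0"
          using ortho_complD(1)[OF orth_proj_diff_in[OF G, of s]] y unfolding e'(2) by blast
        then show ?thesis using inner_orth_proj_right[OF closed_S sS, of y] by simp
      qed
      then have "s - P\<^sub>S e' \<in> F" unfolding F_def using sS by (auto intro: ortho_complI)
      then obtain e where e: "e \<in> E" "s - P\<^sub>S e' = W e" using W(4) by blast
      have "?p (e + e') = e"
        using orth_proj_eq[OF cE e(1)] orth_proj_eq_0[OF cE, of e'] e'(1)
        by (simp add: linear_add[OF lp] E'_def)
      then have "V (e + e') = s" using e(2) by (simp add: V_def algebra_simps)
      moreover have "e + e' \<in> T"
        using e(1) E(2) e'(1) subspace_add[OF subspace_T] unfolding E'_def by blast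
      ultimately show "s \<in> V ` T" by blast
    qed
    show "t = 0" if t: "t \<in> T" "V t = 0" for t
    proof -
      have WF: "W (?p t) \<in> S" "W (?p t) \<in> ortho_compl E'" using W(4) pE unfolding F_def by blast+
      have "inner (P\<^sub>S (t - ?p t)) (W (?p t)) = 0"
        using inner_orth_proj_left[OF closed_S WF(1)] ortho_complD(2)[OF WF(2) qE'[OF t(1)]] by simp
      moreover have "P\<^sub>S (t - ?p t) = - W (?p t)" using t(2) by (simp add: V_def eq_neg_iff_add_eq_0)
      ultimately have "W (?p t) = 0" "P\<^sub>S (t - ?p t) = 0" by auto
      then have "?p t = 0" "t - ?p t = 0"
        using W(3)[OF pE, of t] d(1) d(2)[of "t - ?p t"] qE'[OF t(1)]
        by (auto simp: E'_def mult_le_0_iff)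
      then show ?thesis by simp
    qed
    show "V (J t) = J (V t)" for t
      by (simp add: V_def orth_proj_J[OF E(1)] orth_proj_J[OF S] W(5)[OF pE] linear_add[OF linear_J]
          linear_diff[OF linear_J, symmetric])
    show "0 \<le> 2 * c" using c by simp
    \<comment> \<open>\<open>V\<close> and \<open>P\<^sub>S\<close> differ only on the component in
      \<open>E\<close>, where both \<open>P\<^sub>S\<close> and \<open>W\<close> are contractions;
      this gives the factor 2.\<close>
    show "norm (P\<^sub>S t - V t) \<le> 2 * c * norm (t - P\<^sub>S t)" if "t \<in> T" for t
    proof -
      have "P\<^sub>S t - V t = P\<^sub>S (?p t) - W (?p t)" by (simp add: V_def linear_diff[OF linear_PS])
      also have "norm \<dots> \<le> 2 * norm (?p t)"
        using norm_triangle_ineq4[of "P\<^sub>S (?p t)" "W (?p t)"] norm_orth_proj_le[OF closed_S, of "?p t"] W(2)[of "?p t"]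
        by linarith
      finally show ?thesis using c(2)[OF that] by simp
    qed
  qed
qed

section \<open>The difference of the projections and the compact case\<close>

definition "A x = P\<^sub>S x - P\<^sub>T x"
definition "N1 = S \<inter> ortho_compl T"
definition "N2 = T \<inter> ortho_compl S"
definition "H0 = ortho_compl N1 \<inter> ortho_compl N2"

lemma closed_N1: "closed_csubspace J N1" and closed_N2: "closed_csubspace J N2" and closed_H0: "closed_csubspace J H0"
  unfolding N1_def N2_def H0_def by (intro closed_csubspace_Int closed_csubspace_ortho_compl S T)+

text \<open>Orthogonality to \<open>N1\<close> is automatic, since \<open>N1\<close> lies in
  \<open>T\<^sup>\<bottom>\<close>.\<close>

lemma T_N2_subset_H0: "t \<in> T \<Longrightarrow> t \<in> ortho_compl N2 \<Longrightarrow> t \<in> H0"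
  by (auto simp: H0_def N1_def ortho_compl_def inner_commute)

text \<open>The criterion is applied with \<open>E = N2\<close>. On the complement of
  \<open>N2\<close> in \<open>T\<close>, \<open>P\<^sub>S\<close> is injective and
  \<open>P\<^sub>S - 1\<close> coincides with the compact \<open>A\<close>, so
  \<open>P\<^sub>S\<close> is bounded below there. As \<open>N2\<close> lies in
  \<open>S\<^sup>\<bottom>\<close>, its projection factors through \<open>1 - P\<^sub>S\<close>,
  giving \<open>c = 1\<close>.\<close>

lemma common_complement_compact:
  assumes D: "countable (D::'a set)" "closure D = UNIV"
    and comp: "compact_restriction A H0" and dim: "cdim J N1 = cdim J N2"
  shows "have_common_complement J S T"
proof -
  note c2 = closed_csubspaceD(1)[OF closed_N2]
  have "\<exists>d>0. \<forall>t\<in>T \<inter> ortho_compl N2. d * norm t \<le> norm (P\<^sub>S t)"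
  proof (rule bounded_below_of_compact[OF bounded_linear_orth_proj[OF closed_S]])
    show "closed_subspace (T \<inter> ortho_compl N2)"
      by (intro closed_subspace_Int closed_T closed_subspace_ortho_compl)
    show "t = 0" if "t \<in> T \<inter> ortho_compl N2" "P\<^sub>S t = 0" for t
      using that orth_proj_eq_0D[OF closed_S, of t] ortho_compl_Int_self[of t N2] by (auto simp: N2_def)
    fix f :: "nat \<Rightarrow> 'a" assume f: "\<And>n. f n \<in> T \<inter> ortho_compl N2" "\<And>n. norm (f n) \<le> 1"
    have eq: "A (f n) = P\<^sub>S (f n) - f n" for n
      using f(1)[of n] by (simp add: A_def orth_proj_eq[OF closed_T])
    have fH: "f n \<in> H0" for n using f(1)[of n] T_N2_subset_H0 by simp
    obtain r l where "strict_mono (r::nat \<Rightarrow> nat)" "(\<lambda>n. A (f (r n))) \<longlonglongrightarrow> l"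
      by (rule compact_restrictionD[OF comp fH f(2)])
    then show "\<exists>r l. strict_mono (r::nat \<Rightarrow> nat) \<and> (\<lambda>n. P\<^sub>S (f (r n)) - f (r n)) \<longlonglongrightarrow> l"
      unfolding eq by (intro exI conjI)
  qed
  then obtain d where d: "d > 0" "\<And>t. t \<in> T \<Longrightarrow> t \<in> ortho_compl N2 \<Longrightarrow> d * norm t \<le> norm (P\<^sub>S t)"
    by blast
  \<comment> \<open>Vectors of \<open>S\<close> are orthogonal to \<open>N2\<close> anyway, so
    orthogonality to the rest of \<open>T\<close> is orthogonality to all of
    \<open>T\<close>.\<close>
  have "S \<inter> ortho_compl (T \<inter> ortho_compl N2) = N1"
  proof (intro equalityI subsetI)
    fix s assume s: "s \<in> S \<inter> ortho_compl (T \<inter> ortho_compl N2)"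
    have "inner s t = 0" if t: "t \<in> T" for t
    proof -
      have p: "orth_proj N2 t \<in> N2" by (rule orth_proj_in[OF c2])
      then have "t - orth_proj N2 t \<in> T \<inter> ortho_compl N2"
        using t orth_proj_diff_in[OF c2] subspace_diff[OF subspace_T t] by (auto simp: N2_def)
      then have "inner s (t - orth_proj N2 t) = 0" using s ortho_complD(1) by blast
      moreover have "inner s (orth_proj N2 t) = 0"
        using p s by (auto simp: N2_def intro: ortho_complD(2))
      ultimately show ?thesis by (simp add: inner_diff_right)
    qed
    then show "s \<in> N1" using s by (auto simp: N1_def intro: ortho_complI)
  qed (auto simp: N1_def ortho_compl_def)
  with dim have dim': "cdim J N2 = cdim J (S \<inter> ortho_compl (T \<inter> ortho_compl N2))" by simp
  have "norm (orth_proj N2 t) \<le> 1 * norm (t - P\<^sub>S t)" for t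
    using orth_proj_subset[OF closed_subspace_ortho_compl[of S] c2, of t]
      norm_orth_proj_le[OF c2, of "t - P\<^sub>S t"] orth_proj_ortho_compl[OF closed_S, of t]
    by (auto simp: N2_def)
  then show ?thesis
    using common_complement_criterion[OF D closed_N2 _ _ _ d dim', of 1] by (auto simp: N2_def)
qed

end

section \<open>Spectral subspaces of the squared difference and the noncompact case\<close>

context subspace_pair
begin

lemma bounded_linear_A: "bounded_linear A"
  unfolding A_def[abs_def] by (intro bounded_linear_sub bounded_linear_orth_proj closed_S closed_T)

lemma linear_A: "linear A" by (rule bounded_linear.linear[OF bounded_linear_A])

lemma norm_A_le: "norm (A x) \<le> 2 * norm x"
  using norm_triangle_ineq4[of "P\<^sub>S x" "P\<^sub>T x"] norm_orth_proj_le[OF closed_S, of x] norm_orth_proj_le[OF closed_T, of x]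
  by (simp add: A_def)

lemma inner_A_swap: "inner (A x) y = inner x (A y)"
  by (simp add: A_def inner_diff_left inner_diff_right inner_orth_proj_swap[OF closed_S] inner_orth_proj_swap[OF closed_T])

lemma PS_idem: "P\<^sub>S (P\<^sub>S x) = P\<^sub>S x" and PT_idem: "P\<^sub>T (P\<^sub>T x) = P\<^sub>T x"
  by (simp_all add: orth_proj_eq[OF closed_S PS_in] orth_proj_eq[OF closed_T PT_in])

text \<open>The reason for squaring: in general \<open>A\<close> does not commute with the two
  projections, while its square does, so spectral subspaces of the square reduce both.\<close>

lemma A_A_commute: "P\<^sub>S (A (A x)) = A (A (P\<^sub>S x))" "P\<^sub>T (A (A x)) = A (A (P\<^sub>T x))" "J (A (A x)) = A (A (J x))"
  by (simp_all add: A_def linear_diff[OF linear_PS] linear_diff[OF linear_PT] linear_diff[OF linear_J]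
      PS_idem PT_idem orth_proj_J[OF S] orth_proj_J[OF T])

lemma norm_A_T: "t \<in> T \<Longrightarrow> norm (A t) = norm (t - P\<^sub>S t)"
  by (simp add: A_def orth_proj_eq[OF closed_T] norm_minus_commute)

text \<open>\<open>M\<close> is the nonnegative part of \<open>A\<^sup>2 - \<delta>\<^sup>2\<close>.
  It is invariant under \<open>J\<close> and both projections because these commute with the square
  of \<open>A\<close>; self-adjointness of the projections makes its complement invariant
  too.\<close>

lemma A_splitting:
  assumes \<delta>: "0 < \<delta>" "\<delta> < 1"
  obtains M where "closed_csubspace J M" "\<And>x. x \<in> M \<Longrightarrow> \<delta> * norm x \<le> norm (A x)"
    "\<And>x. x \<in> ortho_compl M \<Longrightarrow> norm (A x) \<le> \<delta> * norm x"
    "\<And>x. P\<^sub>S (orth_proj M x) = orth_proj M (P\<^sub>S x)" "\<And>x. P\<^sub>T (orth_proj M x) = orth_proj M (P\<^sub>T x)"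
proof -
  \<comment> \<open>The factor 1/8 only normalizes: from the crude bound 2 for the norm of
    \<open>A\<close>, the bracket has norm at most 5, and a contraction is required.\<close>
  define X where "X x = (1/8) *\<^sub>R (A (A x) - (\<delta>^2) *\<^sub>R x)" for x
  have d1: "\<delta>^2 \<le> 1" using \<delta> by (simp add: power_le_one)
  have lX: "linear X"
    unfolding X_def[abs_def]
    by (intro linear_compose_scale_right linear_compose_sub linear_compose[OF linear_A linear_A, unfolded comp_def] linear_ident)
  have nX: "norm (X x) \<le> norm x" for x
  proof -
    have "norm (A (A x) - (\<delta>^2) *\<^sub>R x) \<le> norm (A (A x)) + \<delta>^2 * norm x"
      using norm_triangle_ineq4[of "A (A x)" "(\<delta>^2) *\<^sub>R x"] by simp
    moreover have "\<delta>^2 * norm x \<le> 1 * norm x" using d1 by (intro mult_right_mono) auto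
    ultimately have "norm (A (A x) - (\<delta>^2) *\<^sub>R x) \<le> 8 * norm x"
      using norm_A_le[of "A x"] norm_A_le[of x] norm_ge_zero[of x] by linarith
    then show ?thesis by (simp add: X_def)
  qed
  have sX: "inner (X x) y = inner x (X y)" for x y
    by (simp add: X_def inner_diff_left inner_diff_right inner_A_swap)
  have Xq: "8 * inner (X x) x = norm (A x)^2 - (\<delta> * norm x)^2" for x
    by (simp add: X_def inner_diff_left inner_A_swap power_mult_distrib power2_norm_eq_inner)
  obtain M where M: "closed_subspace M" "\<And>x. x \<in> M \<Longrightarrow> 0 \<le> inner (X x) x"
    "\<And>x. x \<in> ortho_compl M \<Longrightarrow> inner (X x) x \<le> 0"
    "\<And>C x. bounded_linear C \<Longrightarrow> \<forall>y. C (X y) = X (C y) \<Longrightarrow> x \<in> M \<Longrightarrow> C x \<in> M"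
    by (rule spectral_splitting[OF lX nX sX]) (rule that)
  have JM: "J x \<in> M" if "x \<in> M" for x
    by (rule M(4)[OF bounded_linear_J _ that])
      (simp add: X_def linear_scale[OF linear_J] linear_diff[OF linear_J] A_A_commute)
  have SM: "P\<^sub>S x \<in> M" if "x \<in> M" for x
    by (rule M(4)[OF bounded_linear_orth_proj[OF closed_S] _ that])
      (simp add: X_def linear_scale[OF linear_PS] linear_diff[OF linear_PS] A_A_commute)
  have TM: "P\<^sub>T x \<in> M" if "x \<in> M" for x
    by (rule M(4)[OF bounded_linear_orth_proj[OF closed_T] _ that])
      (simp add: X_def linear_scale[OF linear_PT] linear_diff[OF linear_PT] A_A_commute)
  show ?thesis
  proof (rule that[of M])
    show "closed_csubspace J M" by (rule closed_csubspaceI[OF M(1) JM])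
    show "\<delta> * norm x \<le> norm (A x)" if "x \<in> M" for x
    proof (rule power2_le_imp_le)
      show "(\<delta> * norm x)^2 \<le> norm (A x)^2" using M(2)[OF that] Xq[of x] by linarith
    qed simp
    show "norm (A x) \<le> \<delta> * norm x" if "x \<in> ortho_compl M" for x
    proof (rule power2_le_imp_le)
      show "norm (A x)^2 \<le> (\<delta> * norm x)^2" using M(3)[OF that] Xq[of x] by linarith
    qed (use \<delta> in simp)
    show "P\<^sub>S (orth_proj M x) = orth_proj M (P\<^sub>S x)" for x
      by (rule orth_proj_commute[OF M(1) linear_PS SM, symmetric])
        (auto intro!: ortho_complI simp: inner_orth_proj_swap[OF closed_S] ortho_complD(1)[OF _ SM])
    show "P\<^sub>T (orth_proj M x) = orth_proj M (P\<^sub>T x)" for x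
      by (rule orth_proj_commute[OF M(1) linear_PT TM, symmetric])
        (auto intro!: ortho_complI simp: inner_orth_proj_swap[OF closed_T] ortho_complD(1)[OF _ TM])
  qed
qed

text \<open>\<open>P\<^sub>S\<close> is self-adjoint, fixes \<open>N1\<close> pointwise and
  annihilates \<open>N2\<close>, so it preserves the common orthogonal complement.\<close>

lemma H0_PS: "x \<in> H0 \<Longrightarrow> P\<^sub>S x \<in> H0"
  unfolding H0_def
  by (auto intro!: ortho_complI simp: inner_orth_proj_swap[OF closed_S] N1_def N2_def orth_proj_eq[OF closed_S]
      orth_proj_eq_0[OF closed_S] ortho_complD)

lemma H0_PT: "x \<in> H0 \<Longrightarrow> P\<^sub>T x \<in> H0"
  unfolding H0_def
  by (auto intro!: ortho_complI simp: inner_orth_proj_swap[OF closed_T] N1_def N2_def orth_proj_eq[OF closed_T]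
      orth_proj_eq_0[OF closed_T] ortho_complD)

lemma N1_in_H0: "x \<in> S \<Longrightarrow> x \<in> H0 \<Longrightarrow> P\<^sub>T x = 0 \<Longrightarrow> x = 0"
  using orth_proj_eq_0D[OF closed_T, of x] ortho_compl_Int_self[of x N1] by (auto simp: H0_def N1_def)

lemma N2_in_H0: "x \<in> T \<Longrightarrow> x \<in> H0 \<Longrightarrow> P\<^sub>S x = 0 \<Longrightarrow> x = 0"
  using orth_proj_eq_0D[OF closed_S, of x] ortho_compl_Int_self[of x N2] by (auto simp: H0_def N2_def)

text \<open>If \<open>T \<inter> H0 \<inter> M\<close> were finite-dimensional for every
  \<open>\<delta>\<close>, then \<open>A\<close> on the unit ball of \<open>H0\<close> would be
  approximated arbitrarily well by values in compact sets, making its image totally bounded. So some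
  \<open>\<delta>\<close> gives infinite dimension, and the criterion applies with
  \<open>E = T \<inter> M\<close>.\<close>

lemma common_complement_noncompact:
  assumes D: "countable (D::'a set)" "closure D = UNIV"
    and noncomp: "\<not> compact_restriction A H0"
  shows "have_common_complement J S T"
proof -
  have "\<exists>\<delta> M. 0 < \<delta> \<and> \<delta> < 1 \<and> closed_csubspace J M \<and> (\<forall>x\<in>M. \<delta> * norm x \<le> norm (A x))
     \<and> (\<forall>x\<in>ortho_compl M. norm (A x) \<le> \<delta> * norm x)
     \<and> (\<forall>x. P\<^sub>S (orth_proj M x) = orth_proj M (P\<^sub>S x)) \<and> (\<forall>x. P\<^sub>T (orth_proj M x) = orth_proj M (P\<^sub>T x))
     \<and> cdim J (T \<inter> H0 \<inter> M) = \<infinity>"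
  proof (rule ccontr)
    assume neg: "\<not> ?thesis"
    have tb: "\<exists>k. finite k \<and> closure (A ` (H0 \<inter> cball 0 1)) \<subseteq> (\<Union>x\<in>k. ball x e)" if e: "e > 0" for e :: real
    proof -
      \<comment> \<open>The part of a unit-ball vector off \<open>M\<close> contributes at most
        \<open>e / 4\<close>, the net for \<open>K\<close> another \<open>e / 4\<close>; the cap 1/2
        keeps \<open>\<delta>\<close> below 1.\<close>
      define \<delta> where "\<delta> = min (e / 4) (1/2)"
      have \<delta>: "0 < \<delta>" "\<delta> < 1" "\<delta> \<le> e / 4" using e by (auto simp: \<delta>_def)
      obtain M where M: "closed_csubspace J M" "\<And>x. x \<in> M \<Longrightarrow> \<delta> * norm x \<le> norm (A x)"
        "\<And>x. x \<in> ortho_compl M \<Longrightarrow> norm (A x) \<le> \<delta> * norm x"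
        "\<And>x. P\<^sub>S (orth_proj M x) = orth_proj M (P\<^sub>S x)" "\<And>x. P\<^sub>T (orth_proj M x) = orth_proj M (P\<^sub>T x)"
        by (rule A_splitting[OF \<delta>(1,2)]) (rule that)
      note cM = closed_csubspaceD(1)[OF M(1)]
      have MS: "P\<^sub>S x \<in> M" and MT: "P\<^sub>T x \<in> M" if "x \<in> M" for x
        using M(4)[of x] M(5)[of x] orth_proj_in[OF cM] orth_proj_eq[OF cM that] by metis+
      have csT: "closed_csubspace J (T \<inter> H0 \<inter> M)" and csS: "closed_csubspace J (S \<inter> H0 \<inter> M)"
        by (intro closed_csubspace_Int S T closed_H0 M)+
      have finT: "cdim J (T \<inter> H0 \<inter> M) \<noteq> \<infinity>"
      proof
        assume "cdim J (T \<inter> H0 \<inter> M) = \<infinity>"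
        then show False
          by - (rule notE[OF neg], intro exI[of _ \<delta>] exI[of _ M] conjI ballI allI \<delta> M)
      qed
      \<comment> \<open>\<open>P\<^sub>T\<close> embeds this space into
        \<open>T \<inter> H0 \<inter> M\<close>: a vector of \<open>S\<close> in its kernel belongs
        to \<open>N1\<close>, which meets \<open>H0\<close> only in 0.\<close>
      have finS: "cdim J (S \<inter> H0 \<inter> M) \<noteq> \<infinity>"
      proof
        assume "cdim J (S \<inter> H0 \<inter> M) = \<infinity>"
        then have "cdim J (T \<inter> H0 \<inter> M) = \<infinity>"
          by (rule cdim_infinite_image[OF csS csT linear_PT, rotated 2])
            (use PT_in H0_PT MT N1_in_H0 in auto)
        then show False using finT by simp
      qed
      define K where "K = {x - y |x y. x \<in> S \<inter> H0 \<inter> M \<inter> cball 0 1 \<and> y \<in> T \<inter> H0 \<inter> M \<inter> cball 0 1}"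
      have "compact K"
        unfolding K_def
        by (rule compact_differences[OF cdim_finite_compact[OF csS finS] cdim_finite_compact[OF csT finT]])
      then obtain k where k: "finite k" "K \<subseteq> (\<Union>x\<in>k. ball x (e/4))"
        using e unfolding compact_eq_totally_bounded by (meson divide_pos_pos zero_less_numeral)
      have "A x \<in> (\<Union>y\<in>k. cball y (e/2))" if x: "x \<in> H0" "norm x \<le> 1" for x
      proof -
        let ?p = "orth_proj M x"
        have pM: "?p \<in> M" by (rule orth_proj_in[OF cM])
        have pn: "norm ?p \<le> 1" using norm_orth_proj_le[OF cM, of x] x(2) by linarith
        have pH: "?p \<in> H0"
        proof -
          \<comment> \<open>The projection onto \<open>M\<close> commutes with
            \<open>P\<^sub>S\<close> and \<open>P\<^sub>T\<close>, hence preserves \<open>N1\<close>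
            and \<open>N2\<close>; being self-adjoint it preserves \<open>H0\<close>.\<close>
          have "inner ?p n = 0" if n: "n \<in> N1 \<or> n \<in> N2" for n
          proof -
            have "orth_proj M n \<in> N1 \<or> orth_proj M n \<in> N2"
              using n
            proof
              assume n: "n \<in> N1"
              then have "P\<^sub>S (orth_proj M n) = orth_proj M n" "P\<^sub>T (orth_proj M n) = 0"
                using M(4)[of n] M(5)[of n] orth_proj_eq[OF closed_S, of n] orth_proj_eq_0[OF closed_T, of n]
                  linear_0[OF linear_orth_proj[OF cM]] by (auto simp: N1_def)
              then have "orth_proj M n \<in> N1"
                using PS_in[of "orth_proj M n"] orth_proj_eq_0D[OF closed_T] by (simp add: N1_def)
              then show ?thesis ..
            next
              assume n: "n \<in> N2"
              then have "P\<^sub>T (orth_proj M n) = orth_proj M n" "P\<^sub>S (orth_proj M n) = 0"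
                using M(4)[of n] M(5)[of n] orth_proj_eq[OF closed_T, of n] orth_proj_eq_0[OF closed_S, of n]
                  linear_0[OF linear_orth_proj[OF cM]] by (auto simp: N2_def)
              then have "orth_proj M n \<in> N2"
                using PT_in[of "orth_proj M n"] orth_proj_eq_0D[OF closed_S] by (simp add: N2_def)
              then show ?thesis ..
            qed
            then show ?thesis
              using x(1) unfolding inner_orth_proj_swap[OF cM] H0_def by (auto intro: ortho_complD(1))
          qed
          then show ?thesis unfolding H0_def by (auto intro: ortho_complI)
        qed
        have "P\<^sub>S ?p \<in> S \<inter> H0 \<inter> M \<inter> cball 0 1" "P\<^sub>T ?p \<in> T \<inter> H0 \<inter> M \<inter> cball 0 1"
          using PS_in PT_in H0_PS[OF pH] H0_PT[OF pH] MS[OF pM] MT[OF pM] pn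
            norm_orth_proj_le[OF closed_S, of ?p] norm_orth_proj_le[OF closed_T, of ?p] by auto
        then have "A ?p \<in> K" unfolding K_def A_def by blast
        then obtain y where y: "y \<in> k" "dist y (A ?p) < e/4" using k(2) by auto
        have "norm (A (x - ?p)) \<le> \<delta> * norm (x - ?p)" by (rule M(3)[OF orth_proj_diff_in[OF cM]])
        also have "\<dots> \<le> e/4 * 1"
          using norm_diff_orth_proj_le[OF cM, of x] x(2) \<delta> by (intro mult_mono) auto
        finally have "dist (A ?p) (A x) \<le> e/4"
          by (simp add: dist_norm linear_diff[OF linear_A] norm_minus_commute)
        then have "dist y (A x) \<le> e/2" using y(2) dist_triangle[of y "A x" "A ?p"] by linarith
        then show ?thesis using y(1) by auto
      qed
      then have "A ` (H0 \<inter> cball 0 1) \<subseteq> (\<Union>y\<in>k. cball y (e/2))" by auto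
      \<comment> \<open>A finite union of closed balls is closed, so the cover extends to the
        closure; doubling the radius returns to open balls.\<close>
      then have "closure (A ` (H0 \<inter> cball 0 1)) \<subseteq> (\<Union>y\<in>k. cball y (e/2))"
        using k(1) by (intro closure_minimal closed_UN) auto
      also have "\<dots> \<subseteq> (\<Union>y\<in>k. ball y e)" using e by force
      finally show ?thesis using k(1) by blast
    qed
    have "complete (closure (A ` (H0 \<inter> cball 0 1)))"
      by (simp add: complete_eq_closed)
    then have "compact (closure (A ` (H0 \<inter> cball 0 1)))"
      using tb by (simp add: compact_eq_totally_bounded)
    then show False using noncomp by (simp add: compact_restriction_def)
  qed
  then obtain \<delta> M where \<delta>: "0 < \<delta>" "\<delta> < 1" and M: "closed_csubspace J M"
    and lower: "\<And>x. x \<in> M \<Longrightarrow> \<delta> * norm x \<le> norm (A x)"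
    and upper: "\<And>x. x \<in> ortho_compl M \<Longrightarrow> norm (A x) \<le> \<delta> * norm x"
    and PSM: "\<And>x. P\<^sub>S (orth_proj M x) = orth_proj M (P\<^sub>S x)"
    and PTM: "\<And>x. P\<^sub>T (orth_proj M x) = orth_proj M (P\<^sub>T x)"
    and inf: "cdim J (T \<inter> H0 \<inter> M) = \<infinity>" by blast
  note cM = closed_csubspaceD(1)[OF M]
  define E where "E = T \<inter> M"
  have E: "closed_csubspace J E" unfolding E_def by (rule closed_csubspace_Int[OF T M])
  have PE: "orth_proj E t = orth_proj M t" if t: "t \<in> T" for t
  proof (rule orth_proj_unique[OF closed_csubspaceD(1)[OF E]])
    have "orth_proj M t \<in> T"
      using PTM[of t] orth_proj_eq[OF closed_T t] PT_in[of "orth_proj M t"] by simp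
    then show "orth_proj M t \<in> E" using orth_proj_in[OF cM] by (simp add: E_def)
    show "t - orth_proj M t \<in> ortho_compl E"
      using orth_proj_diff_in[OF cM, of t] by (auto simp: E_def ortho_compl_def)
  qed
  have EM: "t \<in> ortho_compl M" if "t \<in> T" "t \<in> ortho_compl E" for t
    using PE[OF that(1)] orth_proj_eq_0[OF closed_csubspaceD(1)[OF E] that(2)] orth_proj_eq_0D[OF cM] by simp
  have E0: "closed_csubspace J (T \<inter> H0 \<inter> M)" by (intro closed_csubspace_Int T closed_H0 M)
  have F: "closed_csubspace J (S \<inter> ortho_compl (T \<inter> ortho_compl E))"
    by (intro closed_csubspace_Int closed_csubspace_ortho_compl S T E)
  have infE: "cdim J E = \<infinity>"
    by (rule cdim_infinite_image[OF E0 E linear_ident _ _ inf]) (auto simp: E_def)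
  \<comment> \<open>\<open>P\<^sub>S\<close> embeds \<open>T \<inter> H0 \<inter> M\<close> into
    this space: its kernel on \<open>T \<inter> H0\<close> is trivial, its values stay in
    \<open>M\<close>, and the complement of \<open>E\<close> in \<open>T\<close> is orthogonal to
    \<open>M\<close>.\<close>
  have infF: "cdim J (S \<inter> ortho_compl (T \<inter> ortho_compl E)) = \<infinity>"
  proof (rule cdim_infinite_image[OF E0 F linear_PS _ _ inf])
    fix x assume x: "x \<in> T \<inter> H0 \<inter> M"
    have "P\<^sub>S x \<in> M" using PSM[of x] orth_proj_eq[OF cM, of x] x orth_proj_in[OF cM, of "P\<^sub>S x"] by simp
    then have "P\<^sub>S x \<in> ortho_compl (T \<inter> ortho_compl E)"
      using EM by (auto intro!: ortho_complI intro: ortho_complD(2))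
    then show "P\<^sub>S x \<in> S \<inter> ortho_compl (T \<inter> ortho_compl E)" using PS_in by simp
  qed (use N2_in_H0 in auto)
  show ?thesis
  \<comment> \<open>Both constants come from \<open>norm (A t) = norm (t - P\<^sub>S t)\<close> on
    \<open>T\<close>: the lower bound for \<open>A\<close> on \<open>M\<close> gives
    \<open>1 / \<delta>\<close>, and the upper bound on its complement gives the square root by
    Pythagoras.\<close>
  proof (rule common_complement_criterion[OF D E, of "1 / \<delta>" "sqrt (1 - \<delta>^2)"])
    show "E \<subseteq> T" by (simp add: E_def)
    show "0 \<le> 1 / \<delta>" using \<delta> by simp
    show "norm (orth_proj E t) \<le> 1 / \<delta> * norm (t - P\<^sub>S t)" if t: "t \<in> T" for t
    proof -
      have "A (orth_proj M t) = orth_proj M (A t)"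
        by (simp add: A_def PSM PTM linear_diff[OF linear_orth_proj[OF cM]])
      then have "\<delta> * norm (orth_proj M t) \<le> norm (A t)"
        using lower[OF orth_proj_in[OF cM, of t]] norm_orth_proj_le[OF cM, of "A t"] by simp
      then show ?thesis using \<delta> by (simp add: PE[OF t] norm_A_T[OF t] field_simps)
    qed
    have d2: "\<delta>^2 < 1" using \<delta> by (simp add: power_less_one_iff)
    then show "0 < sqrt (1 - \<delta>^2)" by simp
    show "sqrt (1 - \<delta>^2) * norm t \<le> norm (P\<^sub>S t)" if t: "t \<in> T" "t \<in> ortho_compl E" for t
    proof (rule power2_le_imp_le)
      have "norm (t - P\<^sub>S t) ^ 2 \<le> (\<delta> * norm t) ^ 2"
        using upper[OF EM[OF t]] norm_A_T[OF t(1)] by (intro power_mono) auto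
      then show "(sqrt (1 - \<delta>^2) * norm t) ^ 2 \<le> norm (P\<^sub>S t) ^ 2"
        using norm_orth_proj_pythagoras[OF closed_S, of t] d2 by (simp add: power_mult_distrib algebra_simps)
    qed simp
    show "cdim J E = cdim J (S \<inter> ortho_compl (T \<inter> ortho_compl E))" using infE infF by simp
  qed
qed

end

section \<open>The Fredholm alternative and oblique projections\<close>

text \<open>Riesz's argument: if \<open>F\<close> were not onto, the iterated images of
  \<open>X\<close> would form a strictly decreasing chain of closed subspaces. Unit vectors, each
  orthogonal to the next subspace, have images under \<open>F - 1\<close> at mutual distance at
  least 1, against compactness.\<close>

theorem Fredholm_alternative:
  fixes F :: "'a::{real_inner,complete_space} \<Rightarrow> 'a"
  assumes F: "bounded_linear F" and X: "closed_subspace X" and FX: "F ` X \<subseteq> X"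
    and inj: "\<And>x. x \<in> X \<Longrightarrow> F x = 0 \<Longrightarrow> x = 0"
    and comp: "\<And>f. (\<And>n. f n \<in> X) \<Longrightarrow> (\<And>n. norm (f n) \<le> 1) \<Longrightarrow>
      \<exists>r l. strict_mono (r::nat \<Rightarrow> nat) \<and> (\<lambda>n. F (f (r n)) - f (r n)) \<longlonglongrightarrow> l"
  shows "F ` X = X"
proof (rule ccontr)
  assume neq: "F ` X \<noteq> X"
  obtain d where d: "d > 0" "\<And>x. x \<in> X \<Longrightarrow> d * norm x \<le> norm (F x)"
    using bounded_below_of_compact[OF F X inj comp] by blast
  have injF: "inj_on F X"
    using inj by (subst linear_injective_on_subspace_0[OF bounded_linear.linear[OF F] closed_subspaceD(1)[OF X]]) blast
  define R where "R n = ((`) F ^^ n) X" for n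
  have R0: "R 0 = X" and RS: "R (Suc n) = F ` R n" for n by (simp_all add: R_def)
  have RX: "R n \<subseteq> X" for n by (induction n) (use FX in \<open>auto simp: R0 RS\<close>)
  have Rdec1: "R (Suc n) \<subseteq> R n" for n
  proof (induction n)
    case 0 show ?case using FX by (simp add: R0 RS)
  next
    case (Suc n) then show ?case unfolding RS[of "Suc n"] RS[of n] by blast
  qed
  have Rdec: "R m \<subseteq> R n" if "n \<le> m" for m n
    using that by (induction m rule: dec_induct) (use Rdec1 in blast)+
  have Rneq: "R (Suc n) \<noteq> R n" for n
  proof (induction n)
    case 0 show ?case using neq by (simp add: R0 RS)
  next
    case (Suc n)
    then show ?case
      using inj_on_image_eq_iff[OF injF RX RX, of "Suc n" n] RS by metis
  qed
  have Rcl: "closed_subspace (R n)" for n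
  proof (induction n)
    case (Suc n)
    show ?case unfolding RS using d RX by (intro closed_image_bounded_below[OF F Suc d(1)]) blast
  qed (simp add: R0 X)
  have "\<exists>u. u \<in> R n \<and> u \<in> ortho_compl (R (Suc n)) \<and> norm u = 1" for n
  proof -
    obtain x where x: "x \<in> R n" "x \<in> ortho_compl (R (Suc n))" "x \<noteq> 0"
      using dense_in_closed_subspaceI[OF Rcl[of n] Rcl[of "Suc n"] Rdec1[of n]] Rneq[of n] by auto
    then have "x /\<^sub>R norm x \<in> R n \<and> x /\<^sub>R norm x \<in> ortho_compl (R (Suc n)) \<and> norm (x /\<^sub>R norm x) = 1"
      by (intro conjI subspace_scale closed_subspaceD(1) Rcl closed_subspace_ortho_compl) auto
    then show ?thesis by blast
  qed
  then obtain u where u: "\<And>n. u n \<in> R n" "\<And>n. u n \<in> ortho_compl (R (Suc n))" "\<And>n. norm (u n) = 1"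
    by metis
  have far: "1 \<le> norm ((F (u m) - u m) - (F (u n) - u n))" if "n < m" for m n
  proof -
    note s = closed_subspaceD(1)[OF Rcl[of "Suc n"]]
    have um: "u m \<in> R (Suc n)" using u(1)[of m] Rdec[of "Suc n" m] that by auto
    have Fum: "F (u m) \<in> R (Suc n)"
      using u(1)[of m] Rdec[of "Suc n" "Suc m"] that RS[of m] by auto
    have Fun: "F (u n) \<in> R (Suc n)" using u(1)[of n] RS[of n] by auto
    \<comment> \<open>For \<open>n < m\<close> all three terms lie in \<open>R (Suc n)\<close>, to
      which \<open>u n\<close> is orthogonal; the difference in question is
      \<open>w + u n\<close>.\<close>
    define w where "w = F (u m) - u m - F (u n)"
    have w: "w \<in> R (Suc n)" unfolding w_def by (intro subspace_diff[OF s] um Fum Fun)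
    have "norm (w + u n) ^ 2 = norm w ^ 2 + norm (u n) ^ 2"
      using ortho_complD(2)[OF u(2) w] by (intro norm_add_Pythagorean) (simp add: orthogonal_def)
    then have "1 ^ 2 \<le> norm (w + u n) ^ 2" by (simp add: u(3))
    then have "1 \<le> norm (w + u n)" by (rule power2_le_imp_le) simp
    then show ?thesis by (simp add: w_def algebra_simps)
  qed
  obtain r l where r: "strict_mono (r::nat \<Rightarrow> nat)" and l: "(\<lambda>n. F (u (r n)) - u (r n)) \<longlonglongrightarrow> l"
    using comp[of u] u(1,3) RX by (metis order_refl subsetD)
  obtain M where M: "\<And>m n. m \<ge> M \<Longrightarrow> n \<ge> M \<Longrightarrow> dist (F (u (r m)) - u (r m)) (F (u (r n)) - u (r n)) < 1"
    using metric_CauchyD[OF LIMSEQ_imp_Cauchy[OF l], of 1] by auto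
  have "r M < r (Suc M)" using r by (simp add: strict_mono_def)
  then show False using far[of "r M" "r (Suc M)"] M[of "Suc M" M] by (simp add: dist_norm)
qed

text \<open>Open mapping argument for addition on \<open>S \<times> Z\<close>. Baire's theorem
  yields approximate decompositions with controlled \<open>S\<close>-part and halved error;
  iterating gives an exact decomposition, which equals the given one because the intersection is
  trivial.\<close>

lemma closed_complement_bounded:
  fixes S Z :: "'a::{real_inner,complete_space} set"
  assumes S: "closed_subspace S" and Z: "closed_subspace Z" and int: "S \<inter> Z = {0}"
    and sum: "\<And>x. \<exists>s\<in>S. \<exists>z\<in>Z. x = s + z"
  shows "\<exists>c\<ge>0. \<forall>s\<in>S. \<forall>z\<in>Z. norm s \<le> c * norm (s + z)"
proof -
  note sS = closed_subspaceD(1)[OF S] and sZ = closed_subspaceD(1)[OF Z]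
  define C where "C n = {s + z |s z. s \<in> S \<and> z \<in> Z \<and> norm s \<le> real n}" for n
  have "\<exists>n. interior (closure (C n)) \<noteq> {}"
  proof (rule ccontr)
    assume neg: "\<nexists>n. interior (closure (C n)) \<noteq> {}"
    have "Met_TC.mtopology interior_of \<Union>(range (\<lambda>n. closure (C n))) = {}"
    proof (rule Met_TC.metric_Baire_category_alt)
      show "Met_TC.mcomplete TYPE('a)"
        by (simp add: complete_UNIV)
    qed (use neg in auto)
    moreover have "\<Union>(range (\<lambda>n. closure (C n))) = UNIV"
    proof -
      have "x \<in> \<Union>(range (\<lambda>n. closure (C n)))" for x
      proof -
        obtain s z where sz: "s \<in> S" "z \<in> Z" "x = s + z" using sum by blast
        obtain n where "norm s \<le> real n" using real_arch_simple by blast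
        then have "x \<in> C n" using sz unfolding C_def by blast
        then show ?thesis using closure_subset by blast
      qed
      then show ?thesis by blast
    qed
    ultimately show False by simp
  qed
  then obtain n x0 where "x0 \<in> interior (closure (C n))" by blast
  then obtain e where e: "e > 0" "ball x0 e \<subseteq> closure (C n)" using mem_interior by blast
  \<comment> \<open>The vector \<open>a *\<^sub>R y\<close> has norm \<open>e / 2\<close>, so
    \<open>x0\<close> and \<open>x0 + a *\<^sub>R y\<close> both lie in the ball. Subtracting
    approximants from \<open>C n\<close> gives an \<open>S\<close>-part of norm at most
    \<open>2 * real n\<close>, and dividing by \<open>a\<close> gives \<open>K * norm y\<close>.
    Tolerance \<open>e / 8\<close> for each leaves error \<open>norm y / 2\<close>.\<close>
  define K where "K = 4 * real n / e"
  have K0: "K \<ge> 0" using e by (simp add: K_def)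
  have step: "\<exists>s\<in>S. \<exists>z\<in>Z. norm s \<le> K * norm y \<and> norm (y - (s + z)) \<le> norm y / 2" for y
  proof (cases "y = 0")
    case True
    then show ?thesis using subspace_0[OF sS] subspace_0[OF sZ] by (intro bexI[of _ 0]) auto
  next
    case False
    define a where "a = e / (2 * norm y)"
    have a: "a > 0" using e False by (simp add: a_def)
    have "x0 + a *\<^sub>R y \<in> closure (C n)" "x0 \<in> closure (C n)"
      using e False by (intro subsetD[OF e(2)]; simp add: a_def dist_norm)+
    moreover have h: "e / 8 > 0" using e by simp
    ultimately obtain p q where pq: "p \<in> C n" "dist p (x0 + a *\<^sub>R y) < e / 8" "q \<in> C n" "dist q x0 < e / 8"
      unfolding closure_approachable by metis
    obtain s z s' z' where sz: "s \<in> S" "z \<in> Z" "norm s \<le> real n" "p = s + z"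
      "s' \<in> S" "z' \<in> Z" "norm s' \<le> real n" "q = s' + z'"
      using pq(1,3) unfolding C_def by blast
    let ?s = "(1 / a) *\<^sub>R (s - s')" and ?z = "(1 / a) *\<^sub>R (z - z')"
    have "norm (s - s') \<le> 2 * real n" using norm_triangle_ineq4[of s s'] sz by linarith
    then have "norm ?s \<le> (1 / a) * (2 * real n)" using a by (simp add: divide_right_mono)
    also have "\<dots> = K * norm y" using e by (simp add: K_def a_def)
    finally have 1: "norm ?s \<le> K * norm y" .
    have "y - (?s + ?z) = (1 / a) *\<^sub>R ((x0 + a *\<^sub>R y - p) - (x0 - q))"
      using a by (simp add: sz algebra_simps)
    also have "norm \<dots> = (1 / a) * norm ((x0 + a *\<^sub>R y - p) - (x0 - q))" using a by simp
    also have "\<dots> \<le> (1 / a) * (e / 4)"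
      using norm_triangle_ineq4[of "x0 + a *\<^sub>R y - p" "x0 - q"] pq(2,4) a
      by (intro mult_left_mono) (auto simp: dist_norm norm_minus_commute)
    also have "\<dots> = norm y / 2" using e by (simp add: a_def)
    finally have 2: "norm (y - (?s + ?z)) \<le> norm y / 2" .
    have "?s \<in> S" "?z \<in> Z" using sz by (auto intro!: subspace_scale subspace_diff sS sZ)
    then show ?thesis using 1 2 by blast
  qed
  then obtain fs fz where f: "\<And>y. fs y \<in> S" "\<And>y. fz y \<in> Z" "\<And>y. norm (fs y) \<le> K * norm y"
    "\<And>y. norm (y - (fs y + fz y)) \<le> norm y / 2" by metis
  have "norm s \<le> 2 * K * norm (s + z)" if s: "s \<in> S" and z: "z \<in> Z" for s z
  proof -
    define x where "x = s + z"
    \<comment> \<open>Successive residuals of \<open>x\<close>; \<open>\<sigma>\<close> collects the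
      \<open>S\<close>-parts split off so far.\<close>
    define y where "y = rec_nat x (\<lambda>n v. v - (fs v + fz v))"
    have y0: "y 0 = x" and yS: "y (Suc n) = y n - (fs (y n) + fz (y n))" for n by (simp_all add: y_def)
    define \<sigma> where "\<sigma> n = (\<Sum>k<n. fs (y k))" for n
    have yn: "norm (y n) \<le> norm x / 2 ^ n" for n
    proof (induction n)
      case (Suc n)
      have "norm (y (Suc n)) \<le> norm (y n) / 2" unfolding yS by (rule f(4))
      also have "\<dots> \<le> (norm x / 2 ^ n) / 2" using Suc by simp
      finally show ?case by simp
    qed (simp add: y0)
    have \<sigma>S: "\<sigma> n \<in> S" for n unfolding \<sigma>_def by (intro subspace_sum[OF sS] f(1))
    have \<sigma>Z: "x - y n - \<sigma> n \<in> Z" for n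
    proof (induction n)
      case 0 show ?case using subspace_0[OF sZ] by (simp add: y0 \<sigma>_def)
    next
      case (Suc n)
      have "x - y (Suc n) - \<sigma> (Suc n) = (x - y n - \<sigma> n) + fz (y n)" by (simp add: yS \<sigma>_def)
      then show ?case using subspace_add[OF sZ Suc f(2)] by metis
    qed
    \<comment> \<open>The right-hand side is the geometric sum of \<open>K * norm x / 2 ^ k\<close>
      over \<open>k\<close> from \<open>n\<close> below \<open>m\<close>.\<close>
    have \<sigma>d: "norm (\<sigma> m - \<sigma> n) \<le> 2 * K * norm x * (1 / 2 ^ n - 1 / 2 ^ m)" if "n \<le> m" for m n
      using that
    proof (induction m rule: dec_induct)
      case (step m)
      have "\<sigma> (Suc m) - \<sigma> n = (\<sigma> m - \<sigma> n) + fs (y m)" by (simp add: \<sigma>_def)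
      then have "norm (\<sigma> (Suc m) - \<sigma> n) \<le> norm (\<sigma> m - \<sigma> n) + norm (fs (y m))"
        using norm_triangle_ineq by metis
      also have "norm (fs (y m)) \<le> K * (norm x / 2 ^ m)"
        using f(3)[of "y m"] mult_left_mono[OF yn[of m] K0] by linarith
      also have "norm (\<sigma> m - \<sigma> n) + K * (norm x / 2 ^ m) \<le> 2 * K * norm x * (1 / 2 ^ n - 1 / 2 ^ m) + K * (norm x / 2 ^ m)"
        using step.IH by simp
      also have "\<dots> = 2 * K * norm x * (1 / 2 ^ n - 1 / 2 ^ Suc m)" by (simp add: field_simps)
      finally show ?case by simp
    qed simp
    have lim0: "(\<lambda>n. c / 2 ^ n) \<longlonglongrightarrow> 0" for c :: real
      using tendsto_mult_right_zero[OF LIMSEQ_power_zero[of "1/2::real"], of c] by (simp add: power_one_over)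
    have "Cauchy \<sigma>"
    proof (rule metric_CauchyI)
      fix \<epsilon> :: real assume eps: "\<epsilon> > 0"
      obtain M where M: "2 * K * norm x / 2 ^ M < \<epsilon> / 2"
        using order_tendstoD(2)[OF lim0, of "\<epsilon> / 2" "2 * K * norm x"] eps by (auto simp: eventually_sequentially)
      have "dist (\<sigma> m) (\<sigma> M) < \<epsilon> / 2" if "m \<ge> M" for m
      proof -
        have "2 * K * norm x * (1 / 2 ^ M - 1 / 2 ^ m) \<le> 2 * K * norm x * (1 / 2 ^ M)"
          using K0 by (intro mult_left_mono) auto
        then show ?thesis using \<sigma>d[OF that] M by (simp add: dist_norm)
      qed
      then have "dist (\<sigma> m) (\<sigma> n) < \<epsilon>" if "m \<ge> M" "n \<ge> M" for m n
        using that by (metis dist_triangle_half_l)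
      then show "\<exists>M. \<forall>m\<ge>M. \<forall>n\<ge>M. dist (\<sigma> m) (\<sigma> n) < \<epsilon>" by blast
    qed
    then obtain l where l: "\<sigma> \<longlonglongrightarrow> l" using Cauchy_convergent convergent_def by blast
    have lS: "l \<in> S" using closed_sequentially[OF closed_subspaceD(2)[OF S]] \<sigma>S l by blast
    have y_lim: "y \<longlonglongrightarrow> 0"
      by (rule Lim_null_comparison[OF _ lim0[of "norm x"]]) (use yn in auto)
    have "(\<lambda>n. x - y n - \<sigma> n) \<longlonglongrightarrow> x - 0 - l" by (intro tendsto_intros y_lim l)
    then have "x - 0 - l \<in> Z" by (rule closed_sequentially[OF closed_subspaceD(2)[OF Z] \<sigma>Z])
    then have "x - l - z \<in> Z" using z subspace_diff[OF sZ] by simp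
    then have "s - l \<in> Z" by (simp add: x_def)
    moreover have "s - l \<in> S" using subspace_diff[OF sS s lS] .
    ultimately have "s - l \<in> {0}" unfolding int[symmetric] by (rule IntI[rotated])
    then have "s = l" by simp
    moreover have "norm l \<le> 2 * K * norm x"
    proof (rule LIMSEQ_le_const2[OF tendsto_norm[OF l]])
      have "2 * K * norm x * (1 / 2 ^ 0 - 1 / 2 ^ n) \<le> 2 * K * norm x * 1" for n
        using K0 by (intro mult_left_mono) auto
      moreover have "norm (\<sigma> n) \<le> 2 * K * norm x * (1 / 2 ^ 0 - 1 / 2 ^ n)" for n
        using \<sigma>d[of 0 n] by (simp add: \<sigma>_def)
      ultimately have "norm (\<sigma> n) \<le> 2 * K * norm x" for n
        using order_trans[of "norm (\<sigma> n)"] by fastforce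
      then show "\<exists>N. \<forall>n\<ge>N. norm (\<sigma> n) \<le> 2 * K * norm x" by blast
    qed
    ultimately show ?thesis by (simp add: x_def)
  qed
  then show ?thesis using K0 by (intro exI[of _ "2 * K"]) auto
qed

section \<open>The obstruction\<close>

text \<open>Exchanging \<open>S\<close> and \<open>T\<close> replaces \<open>A\<close> by its
  negative.\<close>

lemma compact_restriction_uminus:
  assumes "compact_restriction B M"
  shows "compact_restriction (\<lambda>x. - B x) M"
proof -
  have "(\<lambda>x. - B x) ` (M \<inter> cball 0 1) \<subseteq> uminus ` closure (B ` (M \<inter> cball 0 1))"
    using closure_subset[of "B ` (M \<inter> cball 0 1)"] by blast
  moreover have K: "compact (uminus ` closure (B ` (M \<inter> cball 0 1)))"
    using assms unfolding compact_restriction_def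
    by (intro compact_continuous_image continuous_on_minus continuous_on_id) auto
  ultimately have "closure ((\<lambda>x. - B x) ` (M \<inter> cball 0 1)) \<subseteq> uminus ` closure (B ` (M \<inter> cball 0 1))"
    by (intro closure_minimal compact_imp_closed)
  then show ?thesis
    unfolding compact_restriction_def using compact_Int_closed[OF K closed_closure]
    by (metis inf.absorb2)
qed

lemma have_common_complement_sym: "have_common_complement J S T \<Longrightarrow> have_common_complement J T S"
  unfolding have_common_complement_def by (elim ex_forward) simp

context subspace_pair
begin

text \<open>With \<open>P\<close> the oblique projection onto \<open>S\<close> along
  \<open>Z\<close> and \<open>p\<close> the projection onto \<open>N1\<close>, \<open>F\<close>
  sends the part of \<open>P x\<close> off \<open>N1\<close> back by \<open>P\<^sub>T\<close> and
  its \<open>N1\<close> part by \<open>W\<close>. The two pieces land in orthogonal subspaces, so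
  \<open>F\<close> is injective on \<open>X\<close>; it misses \<open>b\<close>, contradicting the
  Fredholm alternative.\<close>

lemma no_common_complement_if_less:
  assumes cc: "have_common_complement J S T" and comp: "compact_restriction A H0"
    and less: "cdim J N1 < cdim J N2"
  shows False
proof -
  obtain Z where Z: "closed_csubspace J Z" "S \<inter> Z = {0}" "T \<inter> Z = {0}"
    and SZ: "{s + z |s z. s \<in> S \<and> z \<in> Z} = UNIV"
    using cc unfolding have_common_complement_def by (elim exE conjE) (rule that)
  note cZ = closed_csubspaceD(1)[OF Z(1)]
  note sZ = closed_subspaceD(1)[OF cZ]
  have sum: "\<exists>s\<in>S. \<exists>z\<in>Z. x = s + z" for x
  proof -
    have "x \<in> {s + z |s z. s \<in> S \<and> z \<in> Z}" using SZ by simp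
    then show ?thesis by blast
  qed
  obtain c where c: "c \<ge> 0" "\<And>s z. s \<in> S \<Longrightarrow> z \<in> Z \<Longrightarrow> norm s \<le> c * norm (s + z)"
    using closed_complement_bounded[OF closed_S cZ Z(2) sum] by blast
  have "\<forall>x. \<exists>s. s \<in> S \<and> x - s \<in> Z"
  proof
    fix x
    obtain s z where "s \<in> S" "z \<in> Z" "x = s + z" using sum by blast
    then have "s \<in> S \<and> x - s \<in> Z" by simp
    then show "\<exists>s. s \<in> S \<and> x - s \<in> Z" ..
  qed
  then obtain P where P: "\<And>x. P x \<in> S" "\<And>x. x - P x \<in> Z" by metis
  have Puniq: "P x = s" if "s \<in> S" "x - s \<in> Z" for x s
  proof -
    have "P x - s \<in> S" by (rule subspace_diff[OF subspace_S P(1) that(1)])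
    moreover have "(x - s) - (x - P x) \<in> Z" by (rule subspace_diff[OF sZ that(2) P(2)])
    ultimately have "P x - s \<in> S \<inter> Z" by simp
    then show ?thesis using Z(2) by simp
  qed
  have bP: "bounded_linear P"
  proof (rule bounded_linear_intro[where K=c])
    fix x y r
    have "(x - P x) + (y - P y) \<in> Z" by (intro subspace_add[OF sZ] P)
    then show "P (x + y) = P x + P y"
      by (intro Puniq subspace_add[OF subspace_S] P) (simp add: algebra_simps)
    have "r *\<^sub>R (x - P x) \<in> Z" by (intro subspace_scale[OF sZ] P)
    then show "P (r *\<^sub>R x) = r *\<^sub>R P x"
      by (intro Puniq subspace_scale[OF subspace_S] P) (simp add: algebra_simps)
    show "norm (P x) \<le> norm x * c" using c(2)[OF P(1) P(2), of x x] by (simp add: mult.commute)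
  qed
  note lP = bounded_linear.linear[OF bP]
  have PS: "P s = s" if "s \<in> S" for s using that subspace_0[OF sZ] by (intro Puniq) auto
  obtain W N b where W: "linear W" "\<And>x. norm (W x) \<le> norm x" "\<And>x. x \<in> N1 \<Longrightarrow> norm (W x) = norm x"
    "W ` N1 \<subseteq> N" and N: "closed_csubspace J N" "N \<subseteq> N2" "compact (N \<inter> cball 0 1)" and b: "b \<in> N" "b \<notin> W ` N1"
    by (rule isometry_into_larger[OF closed_N1 closed_N2 less]) (rule that)
  have bW: "bounded_linear W"
    using W(1,2) by (intro bounded_linear_intro[where K=1]) (auto simp: linear_add linear_scale)
  note c1 = closed_csubspaceD(1)[OF closed_N1] and c2 = closed_csubspaceD(1)[OF closed_N2]
    and cN = closed_csubspaceD(1)[OF N(1)]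
  define p where "p = orth_proj N1"
  have bp: "bounded_linear p" unfolding p_def by (rule bounded_linear_orth_proj[OF c1])
  note lp = bounded_linear.linear[OF bp]
  have pN1: "p x \<in> N1" "x - p x \<in> ortho_compl N1" for x
    unfolding p_def by (rule orth_proj_in[OF c1], rule orth_proj_diff_in[OF c1])
  \<comment> \<open>Removing \<open>L\<close> from \<open>T\<close> leaves the complement of
    \<open>N2\<close> plus the finite-dimensional \<open>N\<close>, even if \<open>N2\<close> is
    infinite-dimensional.\<close>
  define L where "L = N2 \<inter> ortho_compl N"
  define X where "X = T \<inter> ortho_compl L"
  have X: "closed_subspace X" unfolding X_def by (intro closed_subspace_Int closed_T closed_subspace_ortho_compl)
  note sX = closed_subspaceD(1)[OF X]
  define U where "U x = P\<^sub>T (P x - p (P x))" for x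
  define F where "F x = U x + W (p (P x))" for x
  have bU: "bounded_linear U"
    unfolding U_def[abs_def]
    by (intro bounded_linear_compose[OF bounded_linear_orth_proj[OF closed_T]] bounded_linear_sub bP
        bounded_linear_compose[OF bp bP])
  have bF: "bounded_linear F"
    unfolding F_def[abs_def]
    by (intro bounded_linear_add bU bounded_linear_compose[OF bW bounded_linear_compose[OF bp bP]])
  note lF = bounded_linear.linear[OF bF]
  have N1S: "N1 \<subseteq> S" and N2T: "N2 \<subseteq> T" by (auto simp: N1_def N2_def)
  have s0S: "P x - p (P x) \<in> S" for x
    using subspace_diff[OF subspace_S P(1)[of x]] pN1(1)[of "P x"] N1S by blast
  have UT: "U x \<in> T" for x unfolding U_def by (rule PT_in)
  \<comment> \<open>On \<open>N2\<close>, which lies in \<open>T\<close>, the map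
    \<open>P\<^sub>T\<close> does not change inner products, and vectors of \<open>S\<close> are
    orthogonal to \<open>N2\<close>.\<close>
  have UN2: "U x \<in> ortho_compl N2" for x
  proof (rule ortho_complI)
    fix n assume n: "n \<in> N2"
    have "inner (U x) n = inner (P x - p (P x)) n"
      unfolding U_def using n N2T by (intro inner_orth_proj_left[OF closed_T]) blast
    also have "\<dots> = 0" using n s0S[of x] by (auto simp: N2_def intro: ortho_complD(2))
    finally show "inner (U x) n = 0" .
  qed
  have WN: "W (p (P x)) \<in> N" for x using W(4) pN1(1) by blast
  have NX: "n \<in> X" if "n \<in> N" for n
    using that N(2) N2T by (auto simp: X_def L_def intro!: ortho_complI intro: ortho_complD(2))
  have UX: "U x \<in> X" for x
    using UT[of x] UN2[of x] by (auto simp: X_def L_def ortho_compl_def)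
  have U0: "P x - p (P x) = 0" if "U x = 0" for x
  proof -
    have "P x - p (P x) \<in> ortho_compl T" using that unfolding U_def by (rule orth_proj_eq_0D[OF closed_T])
    then have "P x - p (P x) \<in> N1" using s0S by (simp add: N1_def)
    then show ?thesis using pN1(2) by (rule ortho_compl_Int_self)
  qed
  have "F ` X = X"
  proof (rule Fredholm_alternative[OF bF X])
    show "F ` X \<subseteq> X" unfolding F_def using subspace_add[OF sX UX NX[OF WN]] by blast
  next
    fix x assume x: "x \<in> X" "F x = 0"
    have "U x = - W (p (P x))" using x(2) by (simp add: F_def eq_neg_iff_add_eq_0)
    moreover have "inner (U x) (W (p (P x))) = 0"
      by (rule ortho_complD(1)[OF UN2]) (use WN N(2) in blast)
    ultimately have w0: "W (p (P x)) = 0" and u0: "U x = 0" by auto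
    have "p (P x) = 0" using W(3)[OF pN1(1), of "P x"] w0 by simp
    then have "P x = 0" using U0[OF u0] by simp
    then have "x \<in> Z" using P(2)[of x] by simp
    moreover have "x \<in> T" using x(1) by (simp add: X_def)
    ultimately show "x = 0" using Z(3) by blast
  next
    fix f :: "nat \<Rightarrow> 'a" assume f: "\<And>n. f n \<in> X" "\<And>n. norm (f n) \<le> 1"
    \<comment> \<open>Two sources of compactness: the unit ball of \<open>N\<close> for
      \<open>m\<close>, and \<open>A\<close> on \<open>H0\<close> for the remainder
      \<open>t\<close>, which lies in \<open>T\<close> and is orthogonal to all of
      \<open>N2\<close>.\<close>
    define m where "m n = orth_proj N (f n)" for n
    define t where "t n = f n - m n" for n
    have mN: "m n \<in> N \<inter> cball 0 1" for n
      using orth_proj_in[OF cN, of "f n"] norm_orth_proj_le[OF cN, of "f n"] f(2)[of n] by (simp add: m_def)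
    obtain l1 r1 where r1: "strict_mono (r1::nat \<Rightarrow> nat)" and l1: "(m \<circ> r1) \<longlonglongrightarrow> l1"
      using seq_compactE[OF compact_imp_seq_compact[OF N(3)]] mN by metis
    have tN: "t n \<in> ortho_compl N" for n unfolding t_def m_def by (rule orth_proj_diff_in[OF cN])
    have tT: "t n \<in> T" for n
    proof -
      have "m n \<in> T" using mN N(2) N2T by blast
      then show ?thesis using f(1)[of n] subspace_diff[OF subspace_T] by (simp add: t_def X_def)
    qed
    have tN2: "t n \<in> ortho_compl N2" for n
    proof (rule ortho_complI)
      fix y assume y: "y \<in> N2"
      let ?q = "orth_proj N y"
      have q: "?q \<in> N" by (rule orth_proj_in[OF cN])
      have yq: "y - ?q \<in> L"
        using subspace_diff[OF closed_subspaceD(1)[OF c2] y] q N(2) orth_proj_diff_in[OF cN]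
        unfolding L_def by blast
      have "inner (f n) (y - ?q) = 0" using f(1)[of n] yq by (auto simp: X_def intro: ortho_complD(1))
      moreover have "inner (m n) (y - ?q) = 0"
        using mN[of n] yq by (auto simp: L_def intro: ortho_complD(2))
      moreover have "inner (t n) ?q = 0" by (rule ortho_complD(1)[OF tN q])
      ultimately show "inner (t n) y = 0" by (simp add: t_def inner_diff_left inner_diff_right)
    qed
    have tH: "t n \<in> H0" for n by (rule T_N2_subset_H0[OF tT tN2])
    have t1: "norm (t n) \<le> 1" for n
      using norm_diff_orth_proj_le[OF cN, of "f n"] f(2)[of n] by (simp add: t_def m_def)
    obtain r2 l2 where r2: "strict_mono (r2::nat \<Rightarrow> nat)" and l2: "(\<lambda>n. A (t (r1 (r2 n)))) \<longlonglongrightarrow> l2"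
      by (rule compact_restrictionD[OF comp, of "\<lambda>n. t (r1 n)"]) (use tH t1 in auto)
    \<comment> \<open>\<open>G\<close> is \<open>P\<^sub>T - F\<close>. For \<open>t\<close> in
      \<open>T\<close> orthogonal to \<open>N2\<close>, \<open>P\<^sub>S t = t + A t\<close> and
      \<open>F (P\<^sub>S t) = P\<^sub>T (P\<^sub>S t)\<close>, since \<open>P\<close> fixes
      \<open>S\<close> and \<open>p\<close> kills \<open>P\<^sub>S t\<close>; this gives
      \<open>F t - t = G (A t)\<close>.\<close>
    define G where "G y = P\<^sub>T y - U y - W (p (P y))" for y
    have bG: "bounded_linear G"
      unfolding G_def[abs_def]
      by (intro bounded_linear_sub bU bounded_linear_orth_proj closed_T bounded_linear_compose[OF bW bounded_linear_compose[OF bp bP]])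
    have Ft: "F (t n) - t n = G (A (t n))" for n
    proof -
      have At: "A (t n) = P\<^sub>S (t n) - t n" using orth_proj_eq[OF closed_T tT] by (simp add: A_def)
      have "p (P\<^sub>S (t n)) = p (t n)" unfolding p_def by (rule orth_proj_subset[OF closed_S c1 N1S])
      also have "\<dots> = 0" unfolding p_def using tH[of n] by (intro orth_proj_eq_0[OF c1]) (simp add: H0_def)
      finally have p0: "p (P\<^sub>S (t n)) = 0" .
      have "F (P\<^sub>S (t n)) = P\<^sub>T (P\<^sub>S (t n))"
        by (simp add: F_def U_def p0 PS[OF PS_in] linear_0[OF W(1)])
      also have "\<dots> = P\<^sub>T (A (t n)) + t n"
        using orth_proj_eq[OF closed_T tT[of n]] by (simp add: At linear_diff[OF linear_PT])
      finally have "F (P\<^sub>S (t n)) = P\<^sub>T (A (t n)) + t n" .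
      moreover have "F (t n) = F (P\<^sub>S (t n)) - F (A (t n))" by (simp add: At linear_diff[OF lF])
      ultimately show ?thesis by (simp add: G_def F_def)
    qed
    have eq: "F (f n) - f n = G (A (t n)) + (F (m n) - m n)" for n
    proof -
      have "f n = t n + m n" by (simp add: t_def)
      then have "F (f n) - f n = (F (t n) - t n) + (F (m n) - m n)" by (simp add: linear_add[OF lF])
      then show ?thesis by (simp only: Ft)
    qed
    have "(\<lambda>n. m (r1 (r2 n))) \<longlonglongrightarrow> l1"
      using LIMSEQ_subseq_LIMSEQ[OF l1 r2] by (simp add: comp_def)
    then have "(\<lambda>n. F (f (r1 (r2 n))) - f (r1 (r2 n))) \<longlonglongrightarrow> G l2 + (F l1 - l1)"
      unfolding eq
      by (intro tendsto_add tendsto_diff bounded_linear.tendsto[OF bG l2] bounded_linear.tendsto[OF bF])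
    moreover have "strict_mono (r1 \<circ> r2)" by (rule strict_mono_o[OF r1 r2])
    ultimately show "\<exists>r l. strict_mono (r::nat \<Rightarrow> nat) \<and> (\<lambda>n. F (f (r n)) - f (r n)) \<longlonglongrightarrow> l"
      by (intro exI[of _ "r1 \<circ> r2"] exI[of _ "G l2 + (F l1 - l1)"]) simp
  qed
  then obtain x where "b = F x" using NX[OF b(1)] by blast
  then have "U x = b - W (p (P x))" by (simp add: F_def)
  \<comment> \<open>Being also orthogonal to \<open>N2\<close>, \<open>U x\<close> vanishes, which
    would place \<open>b\<close> in the image of \<open>N1\<close> under \<open>W\<close>.\<close>
  then have "U x \<in> N2"
    using subspace_diff[OF closed_subspaceD(1)[OF cN] b(1) WN[of x]] N(2) by auto
  then have "U x = 0" using UN2 by (rule ortho_compl_Int_self)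
  then have "b = W (p (P x))" using \<open>b = F x\<close> by (simp add: F_def)
  then show False using b(2) pN1(1) by blast
qed

section \<open>Identification of the eigenspaces and assembly of the equivalence\<close>

lemma eigenspace_one: "{x. A x = x} = N1"
proof (intro equalityI subsetI CollectI)
  fix x assume "x \<in> {x. A x = x}"
  then have "x - P\<^sub>S x = - P\<^sub>T x" by (simp add: A_def algebra_simps)
  \<comment> \<open>Pairing with \<open>x\<close> turns the eigenvalue equation into a sum of two
    squares equal to zero.\<close>
  then have "inner (x - P\<^sub>S x) x = - inner (P\<^sub>T x) x" by simp
  moreover have "inner (x - P\<^sub>S x) x = norm (x - P\<^sub>S x) ^ 2"
    using ortho_complD(1)[OF orth_proj_diff_in[OF closed_S] PS_in, of x x]
    by (simp add: power2_norm_eq_inner inner_diff_right)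
  moreover have "inner (P\<^sub>T x) x = norm (P\<^sub>T x) ^ 2"
    using inner_orth_proj_right[OF closed_T PT_in, of x x] by (simp add: power2_norm_eq_inner)
  ultimately have "norm (x - P\<^sub>S x) ^ 2 + norm (P\<^sub>T x) ^ 2 = 0" by simp
  then have "x = P\<^sub>S x" "P\<^sub>T x = 0" by (auto simp: add_nonneg_eq_0_iff)
  then show "x \<in> N1" using PS_in[of x] orth_proj_eq_0D[OF closed_T, of x] by (simp add: N1_def)
next
  fix x assume "x \<in> N1"
  then show "A x = x"
    using orth_proj_eq[OF closed_S, of x] orth_proj_eq_0[OF closed_T, of x] by (simp add: N1_def A_def)
qed

lemma subspace_pair_swap: "subspace_pair J T S"
  by unfold_locales (rule T, rule S)

lemma eigenspace_minus_one: "{x. A x = - x} = N2"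
proof -
  interpret swap: subspace_pair J T S by (rule subspace_pair_swap)
  have "A x = - x \<longleftrightarrow> swap.A x = x" for x
    by (auto simp: A_def swap.A_def algebra_simps)
  then show ?thesis using swap.eigenspace_one by (simp add: swap.N1_def N2_def)
qed

lemma ortho_compl_N1_plus_N2: "ortho_compl (N1 + N2) = H0"
proof (intro equalityI subsetI)
  fix x assume x: "x \<in> ortho_compl (N1 + N2)"
  have "n \<in> N1 + N2" if "n \<in> N1 \<or> n \<in> N2" for n
    using that subspace_0[OF closed_subspaceD(1)[OF closed_csubspaceD(1)[OF closed_N1]]]
      subspace_0[OF closed_subspaceD(1)[OF closed_csubspaceD(1)[OF closed_N2]]]
      set_plus_intro[of n N1 0 N2] set_plus_intro[of 0 N1 n N2] by auto
  then show "x \<in> H0" using x unfolding H0_def by (auto intro!: ortho_complI intro: ortho_complD(1))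
next
  fix x assume "x \<in> H0"
  then show "x \<in> ortho_compl (N1 + N2)"
    unfolding H0_def by (auto intro!: ortho_complI elim!: set_plus_elim simp: inner_add_right ortho_complD(1))
qed

text \<open>Unequal dimensions are ordered one way or the other. Exchanging \<open>S\<close> and
  \<open>T\<close> swaps \<open>N1\<close> with \<open>N2\<close>, negates \<open>A\<close> and
  keeps \<open>H0\<close>, so the obstruction for one order covers both.\<close>

theorem common_complement_iff:
  assumes D: "countable (D::'a set)" "closure D = UNIV"
  shows "\<not> have_common_complement J S T \<longleftrightarrow> (cdim J N1 \<noteq> cdim J N2 \<and> compact_restriction A H0)"
proof -
  interpret swap: subspace_pair J T S by (rule subspace_pair_swap)
  have swap: "swap.A = (\<lambda>x. - A x)" "swap.N1 = N2" "swap.N2 = N1" "swap.H0 = H0"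
    by (auto simp: swap.A_def A_def swap.N1_def N1_def swap.N2_def N2_def swap.H0_def H0_def)
  have "\<not> have_common_complement J S T" if "cdim J N1 \<noteq> cdim J N2" and comp: "compact_restriction A H0"
  proof
    assume cc: "have_common_complement J S T"
    from that(1) consider "cdim J N1 < cdim J N2" | "cdim J N2 < cdim J N1" by (auto simp: neq_iff)
    then show False
    proof cases
      case 1
      then show False by (rule no_common_complement_if_less[OF cc comp])
    next
      case 2
      then show False
        using swap.no_common_complement_if_less[OF have_common_complement_sym[OF cc]]
          compact_restriction_uminus[OF comp] by (simp add: swap)
    qed
  qed
  then show ?thesis
    using common_complement_compact[OF D] common_complement_noncompact[OF D] by blast
qed

end

theorem mainTheorem13:
  fixes J :: "'a::{real_inner, complete_space} \<Rightarrow> 'a"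
    and S T :: "'a set"
  assumes "complex_structure J"
    and "\<exists>D::'a set. countable D \<and> closure D = UNIV"
    and "closed_csubspace J S" and "closed_csubspace J T"
  defines "A \<equiv> (\<lambda>x. orth_proj S x - orth_proj T x)"
  defines "H0 \<equiv> ortho_compl ({x. A x = x} + {x. A x = - x})"
  shows "\<not> have_common_complement J S T \<longleftrightarrow>
           (cdim J {x. A x = x} \<noteq> cdim J {x. A x = - x} \<and> compact_restriction A H0)"
proof -
  interpret pair: subspace_pair J S T
    by unfold_locales (rule assms(1), rule assms(3), rule assms(4))
  obtain D :: "'a set" where D: "countable D" "closure D = UNIV" using assms(2) by blast
  have A: "A = pair.A" by (simp add: fun_eq_iff A_def pair.A_def)
  show ?thesis
    unfolding H0_def A pair.eigenspace_one pair.eigenspace_minus_one pair.ortho_compl_N1_plus_N2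
    by (rule pair.common_complement_iff[OF D])
qed

end
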